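(* Let $X$ be a complex Banach space, $m\in\mathbb{N}$ and $m-1<\alpha\le m$. Let $u\in C^{(m)}(\mathbb{R}_+;X)$ be such that the function $t\mapsto e^{\omega t}u^{(m)}(t)$ is integrable on $\mathbb{R}_+$ for some $0<\omega<1$. Then $$\mathcal{P}(D_t^\alpha u)(n+m)=\int_0^\infty p_{n+m}(t)\,D_t^\alpha u(t)\,dt=\Delta^\alpha\mathcal{P}(u)(n),\qquad n\in\mathbb{N}_0.$$
   Context: $\mathbb{N}=\{1,2,\dots\}$, $\mathbb{N}_0=\{0,1,2,\dots\}$, $\mathbb{R}_+=[0,\infty)$. $C^{(m)}(\mathbb{R}_+;X)$ is the space of continuous functions $\mathbb{R}_+\to X$ with $m$ continuous derivatives. $p_n(t):=e^{-t}\frac{t^n}{n!}$, $t\ge 0$, and the Poisson transformation is $\mathcal{P}(v)(n):=\int_0^\infty p_n(t)v(t)\,dt$, $n\in\mathbb{N}_0$ (for measurable $v$ for which the integrals converge). For $\beta>0$, $g_\beta(t):=\frac{t^{\beta-1}}{\Gamma(\beta)}$ for $t>0$. For $m-1<\alpha<m$ the Riemann-Liouville fractional derivative is $D_t^\alpha u(t):=\frac{d^m}{dt^m}\int_0^t g_{m-\alpha}(t-s)u(s)\,ds$; for $\alpha=m$, $D_t^m u=u^{(m)}$. For $\beta>0$ and $n\in\mathbb{N}_0$, $k^\beta(n):=\frac{\Gamma(\beta+n)}{\Gamma(\beta)\Gamma(n+1)}$. For $v:\mathbb{N}_0\to X$, $\Delta v(n):=v(n+1)-v(n)$ and $\Delta^m$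 is its $m$-fold iterate. For $m-1<\alpha<m$ the Riemann-Liouville fractional difference is $\Delta^\alpha v(n):=\Delta^m\Big(\sum_{j=0}^{\bullet}k^{m-\alpha}(\bullet-j)v(j)\Big)(n)$, i.e. $\Delta^m$ applied to the sequence $n\mapsto\sum_{j=0}^n k^{m-\alpha}(n-j)v(j)$; for $\alpha=m$ it is $\Delta^m$. *)

theory Defs
  imports "HOL-Analysis.Analysis"
begin

section \<open>Complex Banach spaces\<close>

class complex_banach = banach +
  fixes scaleC :: "complex \<Rightarrow> 'a \<Rightarrow> 'a"
  assumes scaleC_add_right: "scaleC a (x + y) = scaleC a x + scaleC a y"
    and scaleC_add_left: "scaleC (a + b) x = scaleC a x + scaleC b x"
    and scaleC_scaleC: "scaleC a (scaleC b x) = scaleC (a * b) x"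
    and scaleC_of_real: "scaleC (complex_of_real r) x = r *\<^sub>R x"
    and norm_scaleC: "norm (scaleC a x) = cmod a * norm x"

instantiation complex :: complex_banach
begin

definition scaleC_complex :: "complex \<Rightarrow> complex \<Rightarrow> complex" where
  "scaleC_complex a x = a * x"

instance
  by standard (simp_all add: scaleC_complex_def algebra_simps norm_mult scaleR_conv_of_real)

end

section \<open>Bochner integral without separability\<close>

text \<open>The library integral \<^const>\<open>has_bochner_integral\<close> requires a second countable codomain,
  which would force the Banach space to be separable. The following is the usual definition for an
  arbitrary normed space: \<open>f\<close> is an almost everywhere limit of integrable simple functions
  (strong measurability) that also converge to \<open>f\<close> in mean. The two notions agree wherever both
  make sense, see \<open>has_bochner_iff\<close> below.\<close>

definition has_bochner :: "real set \<Rightarrow> (real \<Rightarrow> 'a::real_normed_vector) \<Rightarrow> 'a \<Rightarrow> bool" where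
  "has_bochner S f I \<longleftrightarrow>
    (\<exists>s. (\<forall>i::nat. Bochner_Integration.simple_bochner_integrable (lebesgue_on S) (s i)) \<and>
         (AE t in lebesgue_on S. (\<lambda>i. s i t) \<longlonglongrightarrow> f t) \<and>
         ((\<lambda>i. \<integral>\<^sup>+t. ennreal (norm (f t - s i t)) \<partial>lebesgue_on S) \<longlonglongrightarrow> 0) \<and>
         ((\<lambda>i. Bochner_Integration.simple_bochner_integral (lebesgue_on S) (s i)) \<longlonglongrightarrow> I))"

definition bochner_integrable :: "real set \<Rightarrow> (real \<Rightarrow> 'a::real_normed_vector) \<Rightarrow> bool" where
  "bochner_integrable S f \<longleftrightarrow> (\<exists>I. has_bochner S f I)"

definition bochner :: "real set \<Rightarrow> (real \<Rightarrow> 'a::real_normed_vector) \<Rightarrow> 'a" where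
  "bochner S f = (THE I. has_bochner S f I)"

lemma complete_lebesgue_on:
  assumes S: "S \<in> sets lebesgue"
  shows "complete_measure (lebesgue_on S)"
proof
  fix A B assume "A \<subseteq> B" "B \<in> null_sets (lebesgue_on S)"
  then have "B \<in> null_sets lebesgue" "A \<subseteq> S"
    using S by (auto simp: null_sets_restrict_space)
  then have "A \<in> null_sets lebesgue"
    using \<open>A \<subseteq> B\<close> completion.complete2 by blast
  then show "A \<in> sets (lebesgue_on S)"
    using S \<open>A \<subseteq> S\<close> by (auto simp: sets_restrict_space_iff)
qed

lemma (in complete_measure) borel_measurable_AE_limit:
  fixes f :: "'a \<Rightarrow> 'b::metric_space"
  assumes s: "\<And>i. s i \<in> borel_measurable M" and lim: "AE x in M. (\<lambda>i::nat. s i x) \<longlonglongrightarrow> f x"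
  shows "f \<in> borel_measurable M"
proof -
  obtain N where N: "{x \<in> space M. \<not> (\<lambda>i. s i x) \<longlonglongrightarrow> f x} \<subseteq> N" "N \<in> null_sets M"
    using lim by (auto simp: eventually_ae_filter)
  define g where "g x = (if x \<in> N then undefined else f x)" for x
  have g: "g \<in> borel_measurable M"
  proof (rule borel_measurable_LIMSEQ_metric)
    show "(\<lambda>x. if x \<in> N then undefined else s i x) \<in> borel_measurable M" for i
      using N(2) s by (intro measurable_If_set) auto
    show "(\<lambda>i. if x \<in> N then undefined else s i x) \<longlonglongrightarrow> g x" if "x \<in> space M" for x
      using N that by (auto simp: g_def)
  qed
  have "AE x in M. g x = f x"
    using AE_not_in[OF N(2)] by eventually_elim (simp add: g_def)
  show ?thesis
  proof (rule measurableI)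
    fix A :: "'b set" assume A: "A \<in> sets borel"
    show "f -` A \<inter> space M \<in> sets M"
    proof (rule in_sets_AE)
      show "AE x in M. x \<in> g -` A \<inter> space M \<longleftrightarrow> x \<in> f -` A \<inter> space M"
        using \<open>AE x in M. g x = f x\<close> by eventually_elim auto
      show "g -` A \<inter> space M \<in> sets M"
        using g A by (rule measurable_sets)
    qed auto
  qed auto
qed

lemma borel_measurable_simple_bochner_integrable:
  "Bochner_Integration.simple_bochner_integrable M s \<Longrightarrow> s \<in> borel_measurable M"
  by (auto intro: borel_measurable_simple_function elim: simple_bochner_integrable.cases)

lemma has_bochner_unique:
  assumes S: "S \<in> sets lebesgue" and I: "has_bochner S f I" and J: "has_bochner S f J"
  shows "I = J"
proof -
  let ?M = "lebesgue_on S"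
  interpret complete_measure ?M
    using S by (rule complete_lebesgue_on)
  have diff: "(\<lambda>t. norm (f t - r t)) \<in> borel_measurable ?M"
    if s: "\<And>i. Bochner_Integration.simple_bochner_integrable ?M (s i)" "AE t in ?M. (\<lambda>i::nat. s i t) \<longlonglongrightarrow> f t"
      and r: "Bochner_Integration.simple_bochner_integrable ?M r" for s r
  proof (rule borel_measurable_AE_limit)
    show "(\<lambda>t. norm (s i t - r t)) \<in> borel_measurable ?M" for i
      using s(1)[of i] r
      by (intro borel_measurable_simple_bochner_integrable
          simple_bochner_integrable_compose2[where p = "\<lambda>x y. norm (x - y)"]) auto
    show "AE t in ?M. (\<lambda>i. norm (s i t - r t)) \<longlonglongrightarrow> norm (f t - r t)"
      using s(2) by eventually_elim (intro tendsto_intros)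
  qed
  obtain s where s: "\<And>i. Bochner_Integration.simple_bochner_integrable ?M (s i)"
      "AE t in ?M. (\<lambda>i::nat. s i t) \<longlonglongrightarrow> f t"
      "(\<lambda>i. \<integral>\<^sup>+t. ennreal (norm (f t - s i t)) \<partial>?M) \<longlonglongrightarrow> 0"
      "(\<lambda>i. Bochner_Integration.simple_bochner_integral ?M (s i)) \<longlonglongrightarrow> I"
    using I unfolding has_bochner_def by blast
  obtain r where r: "\<And>i. Bochner_Integration.simple_bochner_integrable ?M (r i)"
      "AE t in ?M. (\<lambda>i::nat. r i t) \<longlonglongrightarrow> f t"
      "(\<lambda>i. \<integral>\<^sup>+t. ennreal (norm (f t - r i t)) \<partial>?M) \<longlonglongrightarrow> 0"
      "(\<lambda>i. Bochner_Integration.simple_bochner_integral ?M (r i)) \<longlonglongrightarrow> J"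
    using J unfolding has_bochner_def by blast
  have bound: "ennreal (norm (Bochner_Integration.simple_bochner_integral ?M (s i) - Bochner_Integration.simple_bochner_integral ?M (r i)))
      \<le> (\<integral>\<^sup>+t. ennreal (norm (f t - s i t)) \<partial>?M) + (\<integral>\<^sup>+t. ennreal (norm (f t - r i t)) \<partial>?M)"
    (is "ennreal (norm (?s - ?r)) \<le> ?S + ?R") for i
  proof -
    have "ennreal (norm (?s - ?r)) = norm (Bochner_Integration.simple_bochner_integral ?M (\<lambda>t. s i t - r i t))"
      using s(1)[of i] r(1)[of i] by (subst simple_bochner_integral_diff) auto
    also have "\<dots> \<le> Bochner_Integration.simple_bochner_integral ?M (\<lambda>t. norm (s i t - r i t))"
      using simple_bochner_integrable_compose2[of "(-)" ?M "s i" "r i"] s(1)[of i] r(1)[of i]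
      by (auto intro!: simple_bochner_integral_norm_bound)
    also have "\<dots> = (\<integral>\<^sup>+t. norm (s i t - r i t) \<partial>?M)"
      using simple_bochner_integrable_compose2[of "\<lambda>x y. norm (x - y)" ?M "s i" "r i"]
        s(1)[of i] r(1)[of i]
      by (auto intro!: simple_bochner_integral_eq_nn_integral)
    also have "\<dots> \<le> (\<integral>\<^sup>+t. ennreal (norm (f t - s i t)) + ennreal (norm (f t - r i t)) \<partial>?M)"
    proof (rule nn_integral_mono)
      fix t
      have "norm (s i t - r i t) \<le> norm (f t - s i t) + norm (f t - r i t)"
        by (metis dual_order.refl norm_diff_triangle_le norm_minus_commute)
      then show "ennreal (norm (s i t - r i t)) \<le> ennreal (norm (f t - s i t)) + ennreal (norm (f t - r i t))"
        by (metis ennreal_leI ennreal_plus norm_ge_zero)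
    qed
    also have "\<dots> = ?S + ?R"
      using diff[OF s(1,2) s(1)[of i]] diff[OF s(1,2) r(1)[of i]]
      by (intro nn_integral_add) auto
    finally show ?thesis .
  qed
  have "(\<lambda>i. ennreal (norm (Bochner_Integration.simple_bochner_integral ?M (s i) - Bochner_Integration.simple_bochner_integral ?M (r i))))
      \<longlonglongrightarrow> ennreal (norm (I - J))"
    using s(4) r(4) by (intro tendsto_intros) auto
  moreover have "(\<lambda>i. ennreal (norm (Bochner_Integration.simple_bochner_integral ?M (s i) - Bochner_Integration.simple_bochner_integral ?M (r i))))
      \<longlonglongrightarrow> 0"
  proof (rule tendsto_sandwich[OF always_eventually always_eventually tendsto_const])
    show "(\<lambda>i. (\<integral>\<^sup>+t. ennreal (norm (f t - s i t)) \<partial>?M) + (\<integral>\<^sup>+t. ennreal (norm (f t - r i t)) \<partial>?M))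
        \<longlonglongrightarrow> 0"
      using tendsto_add[OF s(3) r(3)] by simp
  qed (use bound in simp_all)
  ultimately have "ennreal (norm (I - J)) = 0"
    by (rule LIMSEQ_unique)
  then show ?thesis by simp
qed

lemma bochner_eq: "S \<in> sets lebesgue \<Longrightarrow> has_bochner S f I \<Longrightarrow> bochner S f = I"
  unfolding bochner_def using has_bochner_unique by blast

lemma has_bochner_iff:
  fixes f :: "real \<Rightarrow> 'a::{banach, second_countable_topology}"
  assumes S: "S \<in> sets lebesgue"
  shows "has_bochner S f I \<longleftrightarrow> has_bochner_integral (lebesgue_on S) f I"
proof
  let ?M = "lebesgue_on S"
  interpret complete_measure ?M
    using S by (rule complete_lebesgue_on)
  {
    assume "has_bochner S f I"
    then obtain s where s: "\<And>i. Bochner_Integration.simple_bochner_integrable ?M (s i)"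
        "AE t in ?M. (\<lambda>i::nat. s i t) \<longlonglongrightarrow> f t"
        "(\<lambda>i. \<integral>\<^sup>+t. ennreal (norm (f t - s i t)) \<partial>?M) \<longlonglongrightarrow> 0"
        "(\<lambda>i. Bochner_Integration.simple_bochner_integral ?M (s i)) \<longlonglongrightarrow> I"
      unfolding has_bochner_def by blast
    have "f \<in> borel_measurable ?M"
      using borel_measurable_simple_bochner_integrable[OF s(1)] s(2)
      by (rule borel_measurable_AE_limit)
    then show "has_bochner_integral ?M f I"
      using s(1,3,4) by (rule has_bochner_integral.intros)
  next
    assume "has_bochner_integral ?M f I"
    then have f[measurable]: "integrable ?M f" and I: "integral\<^sup>L ?M f = I"
      by (auto intro: integrable.intros has_bochner_integral_integral_eq)
    have [measurable]: "f \<in> borel_measurable ?M"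
      using f by (rule borel_measurable_integrable)
    obtain s where s: "\<And>i. simple_function ?M (s i)"
        "\<And>t. t \<in> space ?M \<Longrightarrow> (\<lambda>i::nat. s i t) \<longlonglongrightarrow> f t"
        "\<And>i t. t \<in> space ?M \<Longrightarrow> norm (s i t) \<le> 2 * norm (f t)"
      using borel_measurable_implies_sequence_metric[OF \<open>f \<in> borel_measurable ?M\<close>, of 0]
      unfolding dist_norm diff_0_right by blast
    have [measurable]: "s i \<in> borel_measurable ?M" for i
      using s(1) by (rule borel_measurable_simple_function)
    have int: "integrable ?M (s i)" for i
      by (rule Bochner_Integration.integrable_bound[of _ "\<lambda>t. 2 * norm (f t)"]) (use f s(3) in auto)
    have sb: "Bochner_Integration.simple_bochner_integrable ?M (s i)" for i
      using s(1) int by (intro simple_bochner_integrableI_bounded) (auto simp: integrable_iff_bounded)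
    have "(\<lambda>i. integral\<^sup>L ?M (\<lambda>t. norm (f t - s i t))) \<longlonglongrightarrow> integral\<^sup>L ?M (\<lambda>t. 0)"
    proof (rule integral_dominated_convergence[where w = "\<lambda>t. 3 * norm (f t)"])
      show "AE t in ?M. (\<lambda>i. norm (f t - s i t)) \<longlonglongrightarrow> 0"
        using s(2) by (intro AE_I2) (auto intro!: tendsto_eq_intros)
      show "AE t in ?M. norm (norm (f t - s i t)) \<le> 3 * norm (f t)" for i
      proof (rule AE_I2)
        fix t assume "t \<in> space ?M"
        then show "norm (norm (f t - s i t)) \<le> 3 * norm (f t)"
          using s(3)[of t i] norm_triangle_ineq4[of "f t" "s i t"] by simp
      qed
    qed (use f in auto)
    then have "(\<lambda>i. ennreal (integral\<^sup>L ?M (\<lambda>t. norm (f t - s i t)))) \<longlonglongrightarrow> ennreal 0"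
      by (intro tendsto_ennrealI) simp
    moreover have "(\<integral>\<^sup>+t. ennreal (norm (f t - s i t)) \<partial>?M) = ennreal (integral\<^sup>L ?M (\<lambda>t. norm (f t - s i t)))" for i
      using f int by (intro nn_integral_eq_integral) auto
    ultimately have mean: "(\<lambda>i. \<integral>\<^sup>+t. ennreal (norm (f t - s i t)) \<partial>?M) \<longlonglongrightarrow> 0"
      by simp
    have "(\<lambda>i. integral\<^sup>L ?M (s i)) \<longlonglongrightarrow> integral\<^sup>L ?M f"
      by (rule integral_dominated_convergence[where w = "\<lambda>t. 2 * norm (f t)"])
        (use f s(2,3) in \<open>auto intro!: AE_I2\<close>)
    moreover have "integral\<^sup>L ?M (s i) = Bochner_Integration.simple_bochner_integral ?M (s i)" for i
      using has_bochner_integral_simple_bochner_integrable[OF sb]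
      by (rule has_bochner_integral_integral_eq)
    ultimately have "(\<lambda>i. Bochner_Integration.simple_bochner_integral ?M (s i)) \<longlonglongrightarrow> I"
      by (simp add: I)
    with sb mean s(2) show "has_bochner S f I"
      unfolding has_bochner_def by (intro exI[of _ s]) auto
  }
qed

section \<open>Derivatives on intervals\<close>

text \<open>Derivatives are taken within \<open>{0..}\<close>: two-sided at \<open>t > 0\<close> and one-sided at \<open>0\<close>; values of
  the functions at negative arguments play no role.\<close>

definition iter_deriv :: "nat \<Rightarrow> (real \<Rightarrow> 'a::real_normed_vector) \<Rightarrow> real \<Rightarrow> 'a" where
  "iter_deriv k f = ((\<lambda>h t. vector_derivative h (at t within {0..})) ^^ k) f"

definition times_differentiable_on :: "nat \<Rightarrow> (real \<Rightarrow> 'a::real_normed_vector) \<Rightarrow> real set \<Rightarrow> bool" where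
  "times_differentiable_on m f S \<longleftrightarrow>
    (\<forall>k<m. \<forall>t\<in>S. iter_deriv k f differentiable (at t within {0..}))"

definition C_nonneg :: "nat \<Rightarrow> (real \<Rightarrow> 'a::real_normed_vector) set" where
  "C_nonneg m = {f. times_differentiable_on m f {0..} \<and> (\<forall>k\<le>m. continuous_on {0..} (iter_deriv k f))}"

section \<open>Poisson transformation\<close>

definition poisson_kernel :: "nat \<Rightarrow> real \<Rightarrow> real" where
  "poisson_kernel n t = exp (- t) * t ^ n / fact n"

definition poisson :: "(real \<Rightarrow> 'a::real_normed_vector) \<Rightarrow> nat \<Rightarrow> 'a" where
  "poisson v n = bochner {0..} (\<lambda>t. poisson_kernel n t *\<^sub>R v t)"

section \<open>Riemann-Liouville fractional derivative and difference\<close>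

text \<open>For an order \<open>\<alpha> > 0\<close>, the integer \<open>m\<close> with \<open>m - 1 < \<alpha> \<le> m\<close> is \<open>nat \<lceil>\<alpha>\<rceil>\<close>. Both
  operators apply an \<open>m\<close>-fold derivative (difference) to a fractional integral (sum) of order
  \<open>m - \<alpha>\<close>, the latter being the identity if \<open>\<alpha> = m\<close>.\<close>

definition frac_kernel :: "real \<Rightarrow> real \<Rightarrow> real" where
  "frac_kernel \<beta> t = t powr (\<beta> - 1) / Gamma \<beta>"

definition RL_integral_part :: "real \<Rightarrow> (real \<Rightarrow> 'a::real_normed_vector) \<Rightarrow> real \<Rightarrow> 'a" where
  "RL_integral_part \<alpha> u t =
    (if \<alpha> = real (nat \<lceil>\<alpha>\<rceil>) then u t
     else bochner {0..t} (\<lambda>s. frac_kernel (real (nat \<lceil>\<alpha>\<rceil>) - \<alpha>) (t - s) *\<^sub>R u s))"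

definition RL_deriv :: "real \<Rightarrow> (real \<Rightarrow> 'a::real_normed_vector) \<Rightarrow> real \<Rightarrow> 'a" where
  "RL_deriv \<alpha> u = iter_deriv (nat \<lceil>\<alpha>\<rceil>) (RL_integral_part \<alpha> u)"

text \<open>Existence of the fractional derivative on \<open>(0, \<infinity>)\<close>. At \<open>t = 0\<close> it need not exist
  (it behaves like \<open>t powr (- \<alpha>)\<close> there).\<close>

definition RL_deriv_exists :: "real \<Rightarrow> (real \<Rightarrow> 'a::real_normed_vector) \<Rightarrow> bool" where
  "RL_deriv_exists \<alpha> u \<longleftrightarrow>
    (\<alpha> \<noteq> real (nat \<lceil>\<alpha>\<rceil>) \<longrightarrow>
      (\<forall>t>0. bochner_integrable {0..t} (\<lambda>s. frac_kernel (real (nat \<lceil>\<alpha>\<rceil>) - \<alpha>) (t - s) *\<^sub>R u s))) \<and>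
    times_differentiable_on (nat \<lceil>\<alpha>\<rceil>) (RL_integral_part \<alpha> u) {0<..}"

definition cesaro :: "real \<Rightarrow> nat \<Rightarrow> real" where
  "cesaro \<beta> n = Gamma (\<beta> + real n) / (Gamma \<beta> * Gamma (real n + 1))"

definition forward_diff :: "(nat \<Rightarrow> 'a::real_normed_vector) \<Rightarrow> nat \<Rightarrow> 'a" where
  "forward_diff v n = v (n + 1) - v n"

definition RL_sum_part :: "real \<Rightarrow> (nat \<Rightarrow> 'a::real_normed_vector) \<Rightarrow> nat \<Rightarrow> 'a" where
  "RL_sum_part \<alpha> v n =
    (if \<alpha> = real (nat \<lceil>\<alpha>\<rceil>) then v n
     else (\<Sum>j\<le>n. cesaro (real (nat \<lceil>\<alpha>\<rceil>) - \<alpha>) (n - j) *\<^sub>R v j))"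

definition RL_diff :: "real \<Rightarrow> (nat \<Rightarrow> 'a::real_normed_vector) \<Rightarrow> nat \<Rightarrow> 'a" where
  "RL_diff \<alpha> v = (forward_diff ^^ nat \<lceil>\<alpha>\<rceil>) (RL_sum_part \<alpha> v)"

end

theory Submission
  imports Defs
begin

text \<open>Put \<open>b = m - \<alpha>\<close>, let \<open>g\<^sub>b\<close> be the kernel of the fractional integral and \<open>p\<^sub>n\<close> the Poisson
kernel; for \<open>b = 0\<close> read the convolution \<open>g\<^sub>b * u\<close> as \<open>u\<close>. Three facts make the Poisson transform carry the fractional derivative to the fractional
difference.

\<^item> Since \<open>p\<^sub>n\<^sub>+\<^sub>1' = p\<^sub>n - p\<^sub>n\<^sub>+\<^sub>1\<close>, integration by parts turns a derivative into a difference: the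
  transform of \<open>h'\<close> at \<open>n + 1\<close> is the forward difference at \<open>n\<close> of the transform of \<open>h\<close>, provided
  that \<open>p\<^sub>n\<^sub>+\<^sub>1 h\<close> vanishes at \<open>0\<close> and at \<open>\<infinity>\<close> (\<open>poisson_integration_by_parts\<close>). Applied \<open>m\<close> times to
  the fractional integral \<open>g\<^sub>b * u\<close> this reduces the theorem to the transform of \<open>g\<^sub>b * u\<close> itself. The
  shift by \<open>m\<close> is what compensates the singularity \<open>t powr (b - m)\<close> of the derivatives at \<open>0\<close>.
\<^item> Since \<open>p\<^sub>n (r + s)\<close> is the sum of \<open>p\<^sub>n\<^sub>-\<^sub>j r * p\<^sub>j s\<close> over \<open>j \<le> n\<close>, the transform of \<open>g\<^sub>b * u\<close> at \<open>n\<close>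
  is the discrete convolution of the integrals of \<open>g\<^sub>b p\<^sub>k\<close> with the transform of \<open>u\<close>; the former are
  the Cesaro numbers, by Euler's integral for the Gamma function (\<open>poisson_frac_conv_limit\<close>).
\<^item> The hypothesis on \<open>u\<^sup>(\<^sup>m\<^sup>)\<close> makes it absolutely integrable. Hence every lower derivative of \<open>u\<close>
  is at most a constant times \<open>exp (t / 4)\<close>, which the factor \<open>exp (- t)\<close> of the Poisson kernel absorbs.

The vector-valued integrals are handled through continuous functions alone, which also covers
non-separable Banach spaces. All functions here are continuous on the open
half-line, and the lemma \<open>has_bochner_exhaustion\<close> computes a Bochner integral as the limit of
Riemann integrals over compact intervals once the norms have bounded integrals. The convolution
\<open>g\<^sub>b * u\<close> is written as an integral over \<open>[0, 1]\<close> of a continuous function by substituting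
\<open>r = t * y powr (1 / b)\<close>, which absorbs the singularity of \<open>g\<^sub>b\<close>. It can then be differentiated under
the integral sign (\<open>frac_conv_has_vector_derivative\<close>), and the exchange of integrations in the second
fact becomes a comparison of two functions of the upper limit that vanish at \<open>0\<close> and have the same
derivative (\<open>poisson_kernel_frac_conv_has_integral\<close>).\<close>

section \<open>Bochner integrals as limits over compact intervals\<close>

lemma simple_bochner_integral_has_integral:
  fixes s :: "real \<Rightarrow> 'a::banach"
  assumes S: "S \<in> sets lebesgue"
    and s: "Bochner_Integration.simple_bochner_integrable (lebesgue_on S) s"
  shows "(s has_integral Bochner_Integration.simple_bochner_integral (lebesgue_on S) s) S"
proof -
  let ?M = "lebesgue_on S" and ?A = "\<lambda>y. {x \<in> S. s x = y}"
  have sf: "simple_function ?M s" and fin: "emeasure ?M {y \<in> space ?M. s y \<noteq> 0} \<noteq> \<infinity>"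
    using s by (auto elim: simple_bochner_integrable.cases)
  have sp: "space ?M = S" by simp
  have finite: "finite (s ` S)" using sf by (simp add: simple_function_def)
  have A: "?A y \<in> sets ?M" for y
  proof -
    have "s -` {y} \<inter> space ?M \<in> sets ?M"
      using sf by (rule simple_functionD)
    moreover have "s -` {y} \<inter> space ?M = ?A y" by auto
    ultimately show ?thesis by simp
  qed
  have summand: "((\<lambda>t. indicat_real (?A y) t *\<^sub>R y) has_integral measure ?M (?A y) *\<^sub>R y) S" for y
  proof (cases "y = 0")
    case False
    have "{t \<in> space ?M. s t \<noteq> 0} \<in> sets ?M"
      using simple_functionD(2)[OF sf, of "- {0}"]
      by (simp add: vimage_def Int_def conj_commute)
    then have "emeasure ?M (?A y) \<le> emeasure ?M {t \<in> space ?M. s t \<noteq> 0}"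
      using False by (intro emeasure_mono) auto
    then have "emeasure ?M (?A y) < \<infinity>"
      using fin by (auto simp: top_unique less_top)
    moreover have "emeasure ?M (?A y) = emeasure lebesgue (?A y)"
      using S by (intro emeasure_restrict_space) auto
    moreover have "?A y \<in> sets lebesgue"
      using A[of y] S by (auto simp: sets_restrict_space_iff)
    ultimately have "?A y \<in> lmeasurable"
      by (auto intro: fmeasurableI)
    then have "(indicat_real (?A y) has_integral measure lebesgue (?A y)) UNIV"
      by (rule lmeasurable_iff_has_integral[THEN iffD1])
    moreover have "indicat_real (?A y) = (\<lambda>t. if t \<in> S then indicat_real (?A y) t else 0)"
      by (auto simp: fun_eq_iff indicator_def)
    ultimately have "((\<lambda>t. if t \<in> S then indicat_real (?A y) t else 0) has_integral measure lebesgue (?A y)) UNIV"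
      by simp
    then have "(indicat_real (?A y) has_integral measure lebesgue (?A y)) S"
      by (simp only: has_integral_restrict_UNIV)
    moreover have "measure ?M (?A y) = measure lebesgue (?A y)"
      using S by (intro measure_restrict_space) auto
    ultimately show ?thesis
      by (auto intro: has_integral_scaleR_left)
  qed auto
  have "((\<lambda>t. \<Sum>y\<in>s ` S. indicat_real (?A y) t *\<^sub>R y) has_integral
      (\<Sum>y\<in>s ` S. measure ?M (?A y) *\<^sub>R y)) S"
    by (intro has_integral_sum finite summand)
  moreover have "(\<Sum>y\<in>s ` S. indicat_real (?A y) t *\<^sub>R y) = s t" if "t \<in> S" for t
  proof -
    have "(\<Sum>y\<in>s ` S. indicat_real (?A y) t *\<^sub>R y) = (\<Sum>y\<in>s ` S. if y = s t then y else 0)"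
      using that by (intro sum.cong) auto
    then show ?thesis using that finite by simp
  qed
  ultimately show ?thesis
    unfolding simple_bochner_integral_def sp
    by (rule has_integral_eq[rotated]) auto
qed

text \<open>With \<open>d\<close> a modulus of uniform continuity for \<open>e\<close>, round \<open>t\<close> down to the grid \<open>a + d * \<int>\<close>.\<close>

lemma continuous_step_approximation:
  fixes f :: "real \<Rightarrow> 'a::real_normed_vector"
  assumes S: "S \<in> sets lebesgue" and sub: "{a..b} \<subseteq> S"
    and f: "continuous_on {a..b} f" and e: "0 < e"
  obtains s where "Bochner_Integration.simple_bochner_integrable (lebesgue_on S) s"
    and "\<And>t. t \<in> {a..b} \<Longrightarrow> norm (f t - s t) \<le> e" and "\<And>t. t \<notin> {a..b} \<Longrightarrow> s t = 0"
proof -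
  have "uniformly_continuous_on {a..b} f"
    by (rule compact_uniformly_continuous[OF f compact_Icc])
  then obtain d where d: "d > 0"
    "\<And>x y. x \<in> {a..b} \<Longrightarrow> y \<in> {a..b} \<Longrightarrow> dist y x < d \<Longrightarrow> dist (f y) (f x) < e"
    using e unfolding uniformly_continuous_on_def by metis
  define s where "s t = (if t \<in> {a..b} then f (a + d * of_int \<lfloor>(t - a) / d\<rfloor>) else 0)" for t
  let ?M = "lebesgue_on S"
  have app: "norm (f t - s t) \<le> e" if t: "t \<in> {a..b}" for t
  proof -
    let ?x = "a + d * of_int \<lfloor>(t - a) / d\<rfloor>"
    have "0 \<le> \<lfloor>(t - a) / d\<rfloor>" using t d by (simp add: zero_le_floor)
    then have "a \<le> ?x" using d by simp
    moreover have "d * of_int \<lfloor>(t - a) / d\<rfloor> \<le> d * ((t - a) / d)"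
      using d by (intro mult_left_mono) auto
    then have "?x \<le> t" using d by simp
    moreover have "(t - a) / d < of_int \<lfloor>(t - a) / d\<rfloor> + 1" by linarith
    then have "t - ?x < d" using d by (simp add: field_simps)
    ultimately have "dist (f t) (f ?x) < e"
      using t by (intro d(2)) (auto simp: dist_real_def)
    then show ?thesis using t by (simp add: s_def dist_norm)
  qed
  have "s ` space ?M \<subseteq> insert 0 ((\<lambda>k. f (a + d * of_int k)) ` {0..\<lfloor>(b - a) / d\<rfloor>})"
    using d by (auto simp: s_def floor_mono divide_right_mono)
  then have fin: "finite (s ` space ?M)"
    by (rule finite_subset) auto
  have meas: "s -` {y} \<inter> space ?M \<in> sets ?M" for y
  proof -
    have "(\<lambda>t::real. \<lfloor>(t - a) / d\<rfloor>) \<in> borel \<rightarrow>\<^sub>M count_space UNIV"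
      by measurable
    then have "(\<lambda>t. f (a + d * of_int \<lfloor>(t - a) / d\<rfloor>)) \<in> borel \<rightarrow>\<^sub>M count_space UNIV"
      by (rule measurable_compose) simp
    then have "s \<in> borel \<rightarrow>\<^sub>M count_space UNIV"
      unfolding s_def by (intro measurable_If) (auto simp: pred_def)
    then have "s -` {y} \<in> sets borel"
      using measurable_sets[of s borel "count_space UNIV" "{y}"] by simp
    then have "s -` {y} \<in> sets lebesgue" by auto
    then show ?thesis using S by (auto simp: sets_restrict_space_iff)
  qed
  have "simple_function ?M s"
    unfolding simple_function_def using fin meas by auto
  moreover have "emeasure ?M {y \<in> space ?M. s y \<noteq> 0} \<noteq> \<infinity>"
  proof -
    have "emeasure ?M {y \<in> space ?M. s y \<noteq> 0} \<le> emeasure ?M {a..b}"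
      using sub S by (intro emeasure_mono) (auto simp: s_def sets_restrict_space_iff split: if_splits)
    also have "\<dots> = emeasure lebesgue {a..b}"
      using sub S by (intro emeasure_restrict_space) auto
    also have "\<dots> < \<infinity>" by (simp add: emeasure_lborel_Icc_eq)
    finally show ?thesis by simp
  qed
  ultimately have "Bochner_Integration.simple_bochner_integrable ?M s" ..
  then show thesis
    using app by (rule that) (auto simp: s_def)
qed

text \<open>On each compact interval, uniform continuity supplies a step function whose total error tends to
\<open>0\<close>; off the interval the error is the tail of the finite integral of the norm. The integrals of the
step functions therefore have the same limit as those of \<open>f\<close>. Only the norm, a real function, is fed
to the convergence theorems of Lebesgue integration.\<close>

lemma has_bochner_exhaustion:
  fixes f :: "real \<Rightarrow> 'a::banach" and a b :: "nat \<Rightarrow> real"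
  assumes S: "S \<in> sets lebesgue" and sub: "\<And>i. {a i..b i} \<subseteq> S"
    and mono: "decseq a" "incseq b"
    and ae: "AE t in lebesgue_on S. \<exists>i. t \<in> {a i..b i}"
    and cont: "\<And>i. continuous_on {a i..b i} f"
    and bound: "\<And>i. integral {a i..b i} (\<lambda>t. norm (f t)) \<le> B"
    and lim: "(\<lambda>i. integral {a i..b i} f) \<longlonglongrightarrow> I"
  shows "has_bochner S f I"
proof -
  let ?M = "lebesgue_on S" and ?K = "\<lambda>i. {a i..b i}"
  interpret complete_measure ?M using S by (rule complete_lebesgue_on)
  \<comment> \<open>the factor in the length keeps the integral of the error over the i-th interval below 1 / (i + 1)\<close>
  define e where "e i = 1 / ((real i + 1) * (\<bar>b i - a i\<bar> + 1))" for i
  have e: "0 < e i" for i by (auto simp: e_def intro!: divide_pos_pos mult_pos_pos)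
  have e1: "e i \<le> 1 / (real i + 1)" and e2: "e i * \<bar>b i - a i\<bar> \<le> 1 / (real i + 1)" for i
  proof -
    have "0 \<le> (real i + 1) * \<bar>b i - a i\<bar>" by simp
    then show "e i \<le> 1 / (real i + 1)" 
      unfolding e_def by (intro divide_left_mono mult_pos_pos) (auto simp: algebra_simps)
    have "\<bar>b i - a i\<bar> / (\<bar>b i - a i\<bar> + 1) / (real i + 1) \<le> 1 / (real i + 1)"
      by (intro divide_right_mono) auto
    then show "e i * \<bar>b i - a i\<bar> \<le> 1 / (real i + 1)"
      unfolding e_def by (simp add: mult.commute)
  qed
  have to0: "(\<lambda>i. 1 / (real i + 1)) \<longlonglongrightarrow> 0"
    using LIMSEQ_inverse_real_of_nat by (simp add: field_simps inverse_eq_divide)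
  have "\<exists>s. Bochner_Integration.simple_bochner_integrable ?M s \<and>
      (\<forall>t\<in>?K i. norm (f t - s t) \<le> e i) \<and> (\<forall>t. t \<notin> ?K i \<longrightarrow> s t = 0)" for i
    using continuous_step_approximation[OF S sub cont e, of i i] by metis
  then obtain s where s: "\<And>i. Bochner_Integration.simple_bochner_integrable ?M (s i)"
    "\<And>i t. t \<in> ?K i \<Longrightarrow> norm (f t - s i t) \<le> e i" "\<And>i t. t \<notin> ?K i \<Longrightarrow> s i t = 0"
    by metis
  have Kmono: "t \<in> ?K j" if "t \<in> ?K i" "i \<le> j" for t i j
    using that decseqD[OF mono(1), of i j] incseqD[OF mono(2), of i j] by auto
  have ptw: "AE t in ?M. (\<lambda>i. s i t) \<longlonglongrightarrow> f t"
    using ae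
  proof eventually_elim
    case (elim t)
    then obtain i where i: "t \<in> ?K i" by blast
    have "(\<lambda>j. f t - s j t) \<longlonglongrightarrow> 0"
    proof (rule Lim_null_comparison[OF _ to0])
      show "\<forall>\<^sub>F j in sequentially. norm (f t - s j t) \<le> 1 / (real j + 1)"
        using eventually_ge_at_top[of i]
        by eventually_elim (use Kmono[OF i] s(2) e1 in \<open>blast intro: order_trans\<close>)
    qed
    from tendsto_diff[OF tendsto_const[of "f t"] this] show ?case by simp
  qed
  have [measurable]: "(\<lambda>t. norm (s i t)) \<in> borel_measurable ?M" for i
    using s(1)[of i]
    by (intro borel_measurable_simple_bochner_integrable
        simple_bochner_integrable_compose2[where p = "\<lambda>x y. norm x"]) auto
  have [measurable]: "(\<lambda>t. norm (f t)) \<in> borel_measurable ?M"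
  proof (rule borel_measurable_AE_limit)
    show "AE t in ?M. (\<lambda>i. norm (s i t)) \<longlonglongrightarrow> norm (f t)"
      using ptw by eventually_elim (intro tendsto_intros)
  qed measurable
  have [measurable]: "?K i \<in> sets ?M" for i
    using sub[of i] S by (auto simp: sets_restrict_space_iff)
  have restr: "(\<integral>\<^sup>+t. g t * indicator (?K i) t \<partial>?M) = (\<integral>\<^sup>+t. g t * indicator (?K i) t \<partial>lborel)" for g i
  proof -
    have "(\<integral>\<^sup>+t. g t * indicator (?K i) t \<partial>?M) = (\<integral>\<^sup>+t. g t * indicator (?K i) t * indicator S t \<partial>lebesgue)"
      using S by (intro nn_integral_restrict_space) auto
    also have "\<dots> = (\<integral>\<^sup>+t. g t * indicator (?K i) t \<partial>lebesgue)"
      using sub[of i] by (intro nn_integral_cong) (auto simp: indicator_def)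
    finally show ?thesis by (simp add: nn_integral_completion)
  qed
  have nn_le: "(\<integral>\<^sup>+t. ennreal (norm (f t)) * indicator (?K i) t \<partial>?M) \<le> ennreal B" for i
  proof -
    have "((\<lambda>t. norm (f t)) has_integral integral (?K i) (\<lambda>t. norm (f t))) (?K i)"
      by (intro integrable_integral integrable_continuous_real continuous_on_norm cont)
    then have "(\<integral>\<^sup>+t. ennreal (norm (f t)) * indicator (?K i) t \<partial>lborel) = ennreal (integral (?K i) (\<lambda>t. norm (f t)))"
      by (intro nn_integral_has_integral_lebesgue') auto
    then show ?thesis unfolding restr using bound[of i] by (simp add: ennreal_leI)
  qed
  have "(\<integral>\<^sup>+t. ennreal (norm (f t)) \<partial>?M) \<le> ennreal B"
  proof -
    have "AE t in ?M. ennreal (norm (f t)) \<le> liminf (\<lambda>i. ennreal (norm (f t)) * indicator (?K i) t)"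
      using ae
    proof eventually_elim
      case (elim t)
      then obtain i where i: "t \<in> ?K i" by blast
      have "\<forall>\<^sub>F j in sequentially. ennreal (norm (f t)) * indicator (?K j) t = ennreal (norm (f t))"
        using eventually_ge_at_top[of i]
        by eventually_elim (use Kmono[OF i] in \<open>auto simp: indicator_def\<close>)
      then have "(\<lambda>j. ennreal (norm (f t)) * indicator (?K j) t) \<longlonglongrightarrow> ennreal (norm (f t))"
        by (rule tendsto_eventually)
      then show ?case by (simp add: lim_imp_Liminf)
    qed
    then have "(\<integral>\<^sup>+t. ennreal (norm (f t)) \<partial>?M) \<le>
        (\<integral>\<^sup>+t. liminf (\<lambda>i. ennreal (norm (f t)) * indicator (?K i) t) \<partial>?M)"
      by (rule nn_integral_mono_AE)
    also have "\<dots> \<le> liminf (\<lambda>i. \<integral>\<^sup>+t. ennreal (norm (f t)) * indicator (?K i) t \<partial>?M)"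
      by (rule nn_integral_liminf) measurable
    also have "\<dots> \<le> limsup (\<lambda>i. \<integral>\<^sup>+t. ennreal (norm (f t)) * indicator (?K i) t \<partial>?M)"
      by (rule Liminf_le_Limsup) simp
    also have "\<dots> \<le> ennreal B"
      using nn_le by (intro Limsup_bounded always_eventually) auto
    finally show ?thesis .
  qed
  then have fin: "(\<integral>\<^sup>+t. ennreal (norm (f t)) \<partial>?M) < \<infinity>"
    by (rule le_less_trans) simp
  have tail: "(\<lambda>i. \<integral>\<^sup>+t. ennreal (norm (f t)) * indicator (- ?K i) t \<partial>?M) \<longlonglongrightarrow> (\<integral>\<^sup>+t. 0 \<partial>?M)"
  proof (rule nn_integral_dominated_convergence[where w = "\<lambda>t. ennreal (norm (f t))"])
    show "AE t in ?M. (\<lambda>i. ennreal (norm (f t)) * indicator (- ?K i) t) \<longlonglongrightarrow> 0"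
      using ae
    proof eventually_elim
      case (elim t)
      then obtain i where i: "t \<in> ?K i" by blast
      have "\<forall>\<^sub>F j in sequentially. ennreal (norm (f t)) * indicator (- ?K j) t = 0"
        using eventually_ge_at_top[of i]
        by eventually_elim (use Kmono[OF i] in \<open>auto simp: indicator_def\<close>)
      then show ?case by (rule tendsto_eventually)
    qed
    show "(\<lambda>t. ennreal (norm (f t)) * indicator (- ?K i) t) \<in> borel_measurable ?M" for i
    proof -
      have "(\<lambda>t. ennreal (norm (f t)) * indicator (space ?M - ?K i) t) \<in> borel_measurable ?M"
        by measurable
      then show ?thesis by (rule measurable_cong[THEN iffD1, rotated]) (auto simp: indicator_def)
    qed
  qed (use fin in \<open>auto simp: indicator_def\<close>)
  have mean: "(\<lambda>i. \<integral>\<^sup>+t. ennreal (norm (f t - s i t)) \<partial>?M) \<longlonglongrightarrow> 0"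
  proof (rule tendsto_sandwich[OF always_eventually always_eventually tendsto_const])
    show "\<forall>i. (\<integral>\<^sup>+t. ennreal (norm (f t - s i t)) \<partial>?M) \<le>
        (\<integral>\<^sup>+t. ennreal (norm (f t)) * indicator (- ?K i) t \<partial>?M) + ennreal (1 / (real i + 1))"
    proof
      fix i
      have "(\<integral>\<^sup>+t. ennreal (norm (f t - s i t)) \<partial>?M) \<le>
          (\<integral>\<^sup>+t. ennreal (norm (f t)) * indicator (space ?M - ?K i) t + ennreal (e i) * indicator (?K i) t \<partial>?M)"
        using s(2,3)[of _ i] by (intro nn_integral_mono) (auto simp: indicator_def intro: ennreal_leI)
      also have "\<dots> = (\<integral>\<^sup>+t. ennreal (norm (f t)) * indicator (space ?M - ?K i) t \<partial>?M)
          + (\<integral>\<^sup>+t. ennreal (e i) * indicator (?K i) t \<partial>?M)"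
        by (rule nn_integral_add) measurable
      also have "(\<integral>\<^sup>+t. ennreal (norm (f t)) * indicator (space ?M - ?K i) t \<partial>?M)
          = (\<integral>\<^sup>+t. ennreal (norm (f t)) * indicator (- ?K i) t \<partial>?M)"
        by (rule nn_integral_cong) (auto simp: indicator_def)
      also have "(\<integral>\<^sup>+t. ennreal (e i) * indicator (?K i) t \<partial>?M) = ennreal (e i) * emeasure lborel (?K i)"
        unfolding restr by (rule nn_integral_cmult_indicator) simp
      also have "\<dots> \<le> ennreal (1 / (real i + 1))"
        using e2[of i] e[of i]
        by (auto simp: emeasure_lborel_Icc_eq ennreal_mult'[symmetric] intro!: ennreal_leI)
      finally show "(\<integral>\<^sup>+t. ennreal (norm (f t - s i t)) \<partial>?M) \<le>
        (\<integral>\<^sup>+t. ennreal (norm (f t)) * indicator (- ?K i) t \<partial>?M) + ennreal (1 / (real i + 1))"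
        by simp
    qed
    show "(\<lambda>i. (\<integral>\<^sup>+t. ennreal (norm (f t)) * indicator (- ?K i) t \<partial>?M) + ennreal (1 / (real i + 1))) \<longlonglongrightarrow> 0"
      using tendsto_add[OF tail tendsto_ennrealI[OF to0]] by simp
  qed simp
  have close: "norm (Bochner_Integration.simple_bochner_integral ?M (s i) - integral (?K i) f) \<le> 1 / (real i + 1)" for i
  proof (cases "a i \<le> b i")
    case True
    have "(s i has_integral Bochner_Integration.simple_bochner_integral ?M (s i)) S"
      by (rule simple_bochner_integral_has_integral[OF S s(1)])
    moreover have "s i = (\<lambda>t. if t \<in> ?K i then s i t else 0)" using s(3) by auto
    ultimately have "(s i has_integral Bochner_Integration.simple_bochner_integral ?M (s i)) (?K i)"
      using has_integral_restrict[OF sub[of i]] by metis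
    moreover have "(f has_integral integral (?K i) f) (?K i)"
      by (intro integrable_integral integrable_continuous_real cont)
    ultimately have "((\<lambda>t. s i t - f t) has_integral
        Bochner_Integration.simple_bochner_integral ?M (s i) - integral (?K i) f) (?K i)"
      by (rule has_integral_diff)
    then have "norm (Bochner_Integration.simple_bochner_integral ?M (s i) - integral (?K i) f)
        \<le> e i * measure lborel (?K i)"
      using s(2)[of _ i] e[of i]
      by (intro has_integral_bound_real) (auto simp: norm_minus_commute)
    also have "\<dots> \<le> 1 / (real i + 1)"
      using e2[of i] True by simp
    finally show ?thesis .
  next
    case False
    then have "s i = (\<lambda>t. 0)" using s(3) by fastforce
    then have "Bochner_Integration.simple_bochner_integral ?M (s i) = 0"
      by (auto simp: simple_bochner_integral_def intro!: sum.neutral)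
    then show ?thesis using False by simp
  qed
  have "(\<lambda>i. Bochner_Integration.simple_bochner_integral ?M (s i) - integral (?K i) f) \<longlonglongrightarrow> 0"
    by (rule Lim_null_comparison[OF always_eventually to0]) (use close in blast)
  from tendsto_add[OF this lim]
  have "(\<lambda>i. Bochner_Integration.simple_bochner_integral ?M (s i)) \<longlonglongrightarrow> I" by simp
  with s(1) ptw mean show ?thesis unfolding has_bochner_def by blast
qed

text \<open>Some simple function is at distance less than \<open>1\<close> in mean, and its norm has a finite integral. The
positive part of \<open>norm (f t) - norm (s t)\<close> replaces \<open>norm (f t - s t)\<close> in the estimate because its
measurability follows from that of the two norms.\<close>

lemma bochner_integrable_nn_integral_finite:
  assumes f: "bochner_integrable S f" and m: "(\<lambda>t. norm (f t)) \<in> borel_measurable (lebesgue_on S)"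
  shows "(\<integral>\<^sup>+t. ennreal (norm (f t)) \<partial>lebesgue_on S) < \<infinity>"
proof -
  let ?M = "lebesgue_on S"
  obtain s where s: "\<And>i::nat. Bochner_Integration.simple_bochner_integrable ?M (s i)"
    "(\<lambda>i. \<integral>\<^sup>+t. ennreal (norm (f t - s i t)) \<partial>?M) \<longlonglongrightarrow> 0"
    using f unfolding bochner_integrable_def has_bochner_def by blast
  have "\<forall>\<^sub>F i in sequentially. (\<integral>\<^sup>+t. ennreal (norm (f t - s i t)) \<partial>?M) < 1"
    using s(2) by (rule order_tendstoD) simp
  then obtain i where i: "(\<integral>\<^sup>+t. ennreal (norm (f t - s i t)) \<partial>?M) < 1"
    by (auto simp: eventually_sequentially)
  have norm_s: "Bochner_Integration.simple_bochner_integrable ?M (\<lambda>t. norm (s i t))"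
    using s(1)[of i] by (intro simple_bochner_integrable_compose2[where p = "\<lambda>x y. norm x"]) auto
  then have sm: "(\<lambda>t. norm (s i t)) \<in> borel_measurable ?M"
    by (rule borel_measurable_simple_bochner_integrable)
  have fin: "(\<integral>\<^sup>+t. ennreal (norm (s i t)) \<partial>?M) < \<infinity>"
    unfolding simple_bochner_integral_eq_nn_integral[OF norm_s norm_ge_zero, symmetric] by simp
  let ?d = "\<lambda>t. norm (f t) - norm (s i t)"
  have "(\<integral>\<^sup>+t. ennreal (norm (f t)) \<partial>?M) \<le> (\<integral>\<^sup>+t. ennreal (?d t) + ennreal (norm (s i t)) \<partial>?M)"
  proof (rule nn_integral_mono)
    fix t
    have "ennreal (norm (f t)) \<le> ennreal (max 0 (?d t) + norm (s i t))"
      by (rule ennreal_leI) simp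
    also have "\<dots> = ennreal (?d t) + ennreal (norm (s i t))"
      by (simp add: ennreal_plus max_def ennreal_neg)
    finally show "ennreal (norm (f t)) \<le> ennreal (?d t) + ennreal (norm (s i t))" .
  qed
  also have "\<dots> = (\<integral>\<^sup>+t. ennreal (?d t) \<partial>?M) + (\<integral>\<^sup>+t. ennreal (norm (s i t)) \<partial>?M)"
    using borel_measurable_diff[OF m sm] sm by (intro nn_integral_add measurable_compose[OF _ measurable_ennreal])
  also have "(\<integral>\<^sup>+t. ennreal (?d t) \<partial>?M) \<le> (\<integral>\<^sup>+t. ennreal (norm (f t - s i t)) \<partial>?M)"
    by (intro nn_integral_mono ennreal_leI norm_triangle_ineq2)
  finally have "(\<integral>\<^sup>+t. ennreal (norm (f t)) \<partial>?M)
      \<le> (\<integral>\<^sup>+t. ennreal (norm (f t - s i t)) \<partial>?M) + (\<integral>\<^sup>+t. ennreal (norm (s i t)) \<partial>?M)"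
    by (simp add: add_right_mono)
  also have "\<dots> < \<infinity>"
    using i fin by (metis ennreal_add_less_top ennreal_one_less_top infinity_ennreal_def order_less_trans)
  finally show ?thesis .
qed

section \<open>Convolution with the fractional kernel\<close>

lemma integral_has_vector_derivative_nonneg:
  fixes f :: "real \<Rightarrow> 'a::banach"
  assumes f: "continuous_on {0..} f" and t: "0 \<le> t"
  shows "((\<lambda>s. integral {0..s} f) has_vector_derivative f t) (at t within {0..})"
proof -
  have "((\<lambda>s. integral {0..s} f) has_vector_derivative f t) (at t within {0..t + 1})"
    using t by (intro integral_has_vector_derivative continuous_on_subset[OF f]) auto
  moreover have "at t within {0..t + 1} = at t within {0..}"
    by (rule at_within_nhd[where S = "{..<t + 1}"]) auto
  ultimately show ?thesis by simp
qed

text \<open>The convolution of \<open>g\<^sub>b q\<close> with \<open>v\<close>, that is the integral of \<open>g\<^sub>b r * q r * v (t - r)\<close> over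
\<open>0 \<le> r \<le> t\<close>, after the substitution \<open>r = t * y powr (1 / b)\<close>. The integrand is now continuous in both
variables over the fixed interval \<open>[0, 1]\<close>.\<close>

definition frac_conv :: "real \<Rightarrow> (real \<Rightarrow> real) \<Rightarrow> (real \<Rightarrow> 'a::banach) \<Rightarrow> real \<Rightarrow> 'a" where
  "frac_conv b q v t = (t powr b / Gamma (b + 1)) *\<^sub>R
    integral {0..1} (\<lambda>y. q (t * y powr (1 / b)) *\<^sub>R v (t * (1 - y powr (1 / b))))"

lemma Gamma_real_plus1:
  assumes "0 < (b::real)"
  shows "Gamma (b + 1) = b * Gamma b" and "Gamma b \<noteq> 0"
proof -
  have "b \<notin> \<int>\<^sub>\<le>\<^sub>0" using assms by (auto elim!: nonpos_Ints_cases)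
  then show "Gamma (b + 1) = b * Gamma b" by (rule Gamma_plus1)
  show "Gamma b \<noteq> 0" using Gamma_real_pos[OF assms] by linarith
qed

lemma powr_unit_interval: "0 \<le> y \<Longrightarrow> y \<le> 1 \<Longrightarrow> 0 < c \<Longrightarrow> y powr c \<le> (1::real)"
  using powr_mono2[of c y 1] by simp

lemma continuous_on_frac_conv_integrand:
  fixes v :: "real \<Rightarrow> 'a::banach"
  assumes b: "0 < b" and q: "continuous_on {0..} q" and v: "continuous_on {0..} v"
  shows "continuous_on ({0..} \<times> {0..1})
    (\<lambda>(t, y). q (t * y powr (1 / b)) *\<^sub>R v (t * (1 - y powr (1 / b))))"
proof -
  have powr: "continuous_on ({0..} \<times> {0..1}) (\<lambda>z::real \<times> real. snd z powr (1 / b))"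
    using b by (intro continuous_on_powr' continuous_intros) auto
  show ?thesis
    unfolding case_prod_beta
    by (intro continuous_intros powr continuous_on_compose2[OF q] continuous_on_compose2[OF v])
      (use b powr_unit_interval in auto)
qed

lemma continuous_on_frac_conv_integrand':
  fixes v :: "real \<Rightarrow> 'a::banach"
  assumes b: "0 < b" and q: "continuous_on {0..} q" and v: "continuous_on {0..} v" and t: "0 \<le> t"
  shows "continuous_on {0..1} (\<lambda>y. q (t * y powr (1 / b)) *\<^sub>R v (t * (1 - y powr (1 / b))))"
  by (rule continuous_on_compose2[OF continuous_on_frac_conv_integrand[OF b q v],
        of "{0..1}" "\<lambda>y. (t, y)", simplified])
    (use t in \<open>auto intro!: continuous_intros\<close>)

lemma integrable_frac_conv_integrand:
  fixes v :: "real \<Rightarrow> 'a::banach"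
  assumes "0 < b" "continuous_on {0..} q" "continuous_on {0..} v" "0 \<le> t"
  shows "(\<lambda>y. q (t * y powr (1 / b)) *\<^sub>R v (t * (1 - y powr (1 / b)))) integrable_on {0..1}"
  by (intro integrable_continuous_real continuous_on_frac_conv_integrand' assms)

lemma frac_conv_0 [simp]: "frac_conv b q v 0 = 0"
  by (simp add: frac_conv_def)

lemma continuous_on_frac_conv:
  fixes v :: "real \<Rightarrow> 'a::banach"
  assumes b: "0 < b" and q: "continuous_on {0..} q" and v: "continuous_on {0..} v"
  shows "continuous_on {0..} (frac_conv b q v)"
proof -
  have "continuous_on {0..} (\<lambda>t::real. t powr b)"
    using b by (intro continuous_on_powr' continuous_intros) auto
  moreover have "continuous_on {0..}
      (\<lambda>t. integral (cbox 0 1) (\<lambda>y. q (t * y powr (1 / b)) *\<^sub>R v (t * (1 - y powr (1 / b)))))"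
    using continuous_on_frac_conv_integrand[OF assms] by (intro integral_continuous_on_param) simp
  ultimately show ?thesis
    unfolding frac_conv_def using b Gamma_real_plus1[OF b]
    by (intro continuous_on_scaleR continuous_on_divide continuous_on_const) auto
qed

text \<open>This is the rule \<open>(k * A)' = k A(0) + k * A'\<close> for the kernel \<open>k = g\<^sub>b q\<close>. Differentiating the integral
over \<open>[0, 1]\<close> also produces derivatives of \<open>q\<close> and of the factor \<open>t powr b\<close>; they cancel, up to the
boundary term, by the fundamental theorem applied to \<open>y *\<^sub>R F t y\<close> with \<open>F t\<close> the integrand.\<close>

lemma frac_conv_has_vector_derivative:
  fixes A :: "real \<Rightarrow> 'a::banach"
  assumes b: "0 < b" and t: "0 < t"
    and q: "\<And>x. 0 \<le> x \<Longrightarrow> (q has_real_derivative q' x) (at x within {0..})"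
    and A: "\<And>x. 0 \<le> x \<Longrightarrow> (A has_vector_derivative A' x) (at x within {0..})"
    and q': "continuous_on {0..} q'" and A': "continuous_on {0..} A'"
  shows "(frac_conv b q A has_vector_derivative
    (frac_kernel b t * q t) *\<^sub>R A 0 + frac_conv b q A' t) (at t)"
proof -
  define p where "p y = y powr (1 / b)" for y :: real
  have p: "0 \<le> p y" "p y \<le> 1" if "y \<in> {0..1}" for y
    using that b by (auto simp: p_def powr_unit_interval)
  have qc: "continuous_on {0..} q"
    using q by (intro DERIV_continuous_on) auto
  have Ac: "continuous_on {0..} A"
    using A by (intro continuous_on_vector_derivative) auto
  have at: "at x within {0..} = at x" if "0 < x" for x :: real
    using that by (intro at_within_interior) auto
  define F where "F x y = q (x * p y) *\<^sub>R A (x * (1 - p y))" for x y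
  define G1 where "G1 x y = q' (x * p y) *\<^sub>R A (x * (1 - p y))" for x y
  define G2 where "G2 x y = q (x * p y) *\<^sub>R A' (x * (1 - p y))" for x y
  have contp: "continuous_on ({0..} \<times> {0..1}) (\<lambda>z::real \<times> real. p (snd z))"
    unfolding p_def using b by (intro continuous_on_powr' continuous_intros) auto
  have "continuous_on ({0..} \<times> {0..1}) (\<lambda>z. G1 (fst z) (snd z))"
    and "continuous_on ({0..} \<times> {0..1}) (\<lambda>z. G2 (fst z) (snd z))"
    using continuous_on_frac_conv_integrand[OF b q' Ac] continuous_on_frac_conv_integrand[OF b qc A']
    unfolding G1_def G2_def p_def case_prod_beta by auto
  then have contG: "continuous_on ({0..} \<times> cbox 0 1) (\<lambda>(x, y). p y *\<^sub>R G1 x y + (1 - p y) *\<^sub>R G2 x y)"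
    unfolding case_prod_beta cbox_interval by (intro continuous_intros contp)
  have "((\<lambda>x. integral (cbox 0 1) (F x)) has_vector_derivative
      integral (cbox 0 1) (\<lambda>y. p y *\<^sub>R G1 t y + (1 - p y) *\<^sub>R G2 t y)) (at t within {0..})"
  proof (rule leibniz_rule_vector_derivative[OF _ _ contG])
    fix x y :: real assume x: "x \<in> {0..}" and y: "y \<in> cbox 0 1"
    have "((\<lambda>x. q (x * p y)) has_real_derivative q' (x * p y) * p y) (at x within {0..})"
      using x p[of y] y
      by (intro DERIV_image_chain[where g = "\<lambda>x. x * p y", unfolded comp_def] DERIV_subset[OF q])
        (auto intro!: derivative_eq_intros)
    moreover have "((A \<circ> (\<lambda>x. x * (1 - p y))) has_vector_derivative (1 - p y) *\<^sub>R A' (x * (1 - p y))) (at x within {0..})"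
    proof (rule vector_diff_chain_within)
      show "((\<lambda>x. x * (1 - p y)) has_vector_derivative 1 - p y) (at x within {0..})"
        unfolding has_real_derivative_iff_has_vector_derivative[symmetric]
        by (auto intro!: derivative_eq_intros)
      show "(A has_vector_derivative A' (x * (1 - p y))) (at (x * (1 - p y)) within (\<lambda>x. x * (1 - p y)) ` {0..})"
        using x p[of y] y by (intro has_vector_derivative_within_subset[OF A]) auto
    qed
    ultimately have "((\<lambda>x. q (x * p y) *\<^sub>R A (x * (1 - p y))) has_vector_derivative
        q (x * p y) *\<^sub>R ((1 - p y) *\<^sub>R A' (x * (1 - p y))) + (q' (x * p y) * p y) *\<^sub>R A (x * (1 - p y)))
        (at x within {0..})"
      unfolding comp_def by (rule has_vector_derivative_scaleR)
    then show "((\<lambda>x. F x y) has_vector_derivative p y *\<^sub>R G1 x y + (1 - p y) *\<^sub>R G2 x y) (at x within {0..})"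
      unfolding F_def G1_def G2_def by (simp add: mult.commute add.commute)
  next
    fix x :: real assume "x \<in> {0..}"
    then show "F x integrable_on cbox 0 1"
      using integrable_frac_conv_integrand[OF b qc Ac, of x] unfolding F_def p_def by simp
  qed (use t in auto)
  then have dF: "((\<lambda>x. integral {0..1} (F x)) has_vector_derivative
      integral {0..1} (\<lambda>y. p y *\<^sub>R G1 t y + (1 - p y) *\<^sub>R G2 t y)) (at t)"
    using t by (simp add: at)
  have "((\<lambda>x. x powr b / Gamma (b + 1)) has_real_derivative frac_kernel b t) (at t)"
    using t b Gamma_real_plus1[OF b]
    by (auto intro!: derivative_eq_intros simp: frac_kernel_def)
  from has_vector_derivative_scaleR[OF this dF]
  have der: "(frac_conv b q A has_vector_derivative
      (t powr b / Gamma (b + 1)) *\<^sub>R integral {0..1} (\<lambda>y. p y *\<^sub>R G1 t y + (1 - p y) *\<^sub>R G2 t y)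
      + frac_kernel b t *\<^sub>R integral {0..1} (F t)) (at t)"
    unfolding frac_conv_def F_def p_def .
  let ?G = "\<lambda>y. p y *\<^sub>R G1 t y - p y *\<^sub>R G2 t y"
  have contp1: "continuous_on {0..1} p"
    unfolding p_def using b by (intro continuous_on_powr' continuous_intros) auto
  have cF: "continuous_on {0..1} (F t)" and cG1: "continuous_on {0..1} (G1 t)" and cG2: "continuous_on {0..1} (G2 t)"
    using continuous_on_frac_conv_integrand'[OF b qc Ac] continuous_on_frac_conv_integrand'[OF b q' Ac]
      continuous_on_frac_conv_integrand'[OF b qc A'] t
    unfolding F_def G1_def G2_def p_def by auto
  have iG: "?G integrable_on {0..1}"
    by (intro integrable_continuous_real continuous_on_diff continuous_on_scaleR contp1 cG1 cG2)
  note iF = integrable_continuous_real[OF cF] and iG2 = integrable_continuous_real[OF cG2]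
  \<comment> \<open>y p'(y) = p(y) / b, so the derivative of y F(t, y) is again free of singularities\<close>
  have "((\<lambda>y. F t y + (t / b) *\<^sub>R ?G y) has_integral 1 *\<^sub>R F t 1 - 0 *\<^sub>R F t 0) {0..1}"
  proof (rule fundamental_theorem_of_calculus_interior)
    show "continuous_on {0..1} (\<lambda>y. y *\<^sub>R F t y)" by (intro continuous_intros cF)
    fix y :: real assume y: "y \<in> {0<..<1}"
    have p': "(p has_real_derivative p y / (b * y)) (at y)"
      unfolding p_def using y by (auto intro!: derivative_eq_intros simp: powr_diff field_simps)
    have py: "0 < p y" "p y < 1"
      using y b powr_less_mono2[of "1 / b" y 1] by (auto simp: p_def)
    have "((\<lambda>y. q (t * p y)) has_real_derivative q' (t * p y) * (t * (p y / (b * y)))) (at y)"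
    proof (rule DERIV_chain2[where f = q and g = "\<lambda>y. t * p y"])
      show "(q has_real_derivative q' (t * p y)) (at (t * p y))"
        using q[of "t * p y"] py t by (simp add: at)
    qed (auto intro!: derivative_eq_intros p')
    moreover have "((A \<circ> (\<lambda>y. t * (1 - p y))) has_vector_derivative (- (t * (p y / (b * y)))) *\<^sub>R A' (t * (1 - p y))) (at y)"
    proof (rule vector_diff_chain_at)
      show "((\<lambda>y. t * (1 - p y)) has_vector_derivative - (t * (p y / (b * y)))) (at y)"
        unfolding has_real_derivative_iff_has_vector_derivative[symmetric]
        by (auto intro!: derivative_eq_intros p')
      show "(A has_vector_derivative A' (t * (1 - p y))) (at (t * (1 - p y)))"
        using A[of "t * (1 - p y)"] py t by (simp add: at)
    qed
    ultimately have "((\<lambda>y. F t y) has_vector_derivative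
        q (t * p y) *\<^sub>R ((- (t * (p y / (b * y)))) *\<^sub>R A' (t * (1 - p y)))
        + (q' (t * p y) * (t * (p y / (b * y)))) *\<^sub>R A (t * (1 - p y))) (at y)"
      unfolding comp_def F_def by (rule has_vector_derivative_scaleR)
    moreover have "q (t * p y) *\<^sub>R ((- (t * (p y / (b * y)))) *\<^sub>R A' (t * (1 - p y)))
        + (q' (t * p y) * (t * (p y / (b * y)))) *\<^sub>R A (t * (1 - p y)) = (t / (b * y)) *\<^sub>R ?G y"
      by (simp add: G1_def G2_def scaleR_diff_right mult_ac)
    ultimately have "((\<lambda>y. F t y) has_vector_derivative (t / (b * y)) *\<^sub>R ?G y) (at y)" by simp
    from has_vector_derivative_scaleR[OF DERIV_ident this]
    have "((\<lambda>y. y *\<^sub>R F t y) has_vector_derivative y *\<^sub>R ((t / (b * y)) *\<^sub>R ?G y) + 1 *\<^sub>R F t y) (at y)" .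
    then show "((\<lambda>y. y *\<^sub>R F t y) has_vector_derivative F t y + (t / b) *\<^sub>R ?G y) (at y)"
      using y by (simp add: add.commute)
  qed simp
  moreover have "((\<lambda>y. F t y + (t / b) *\<^sub>R ?G y) has_integral
      integral {0..1} (F t) + (t / b) *\<^sub>R integral {0..1} ?G) {0..1}"
    by (intro has_integral_add has_integral_cmul integrable_integral iF iG)
  ultimately have key: "integral {0..1} (F t) = q t *\<^sub>R A 0 - (t / b) *\<^sub>R integral {0..1} ?G"
    by (metis (no_types, lifting) F_def add_diff_cancel_right' cancel_comm_monoid_add_class.diff_cancel
        diff_zero has_integral_unique mult.right_neutral mult_zero_right p_def powr_one_eq_one scaleR_one scaleR_zero_left)
  have "integral {0..1} (\<lambda>y. p y *\<^sub>R G1 t y + (1 - p y) *\<^sub>R G2 t y) = integral {0..1} (\<lambda>y. ?G y + G2 t y)"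
    by (simp add: algebra_simps)
  also have "\<dots> = integral {0..1} ?G + integral {0..1} (G2 t)"
    by (intro integral_add iG iG2)
  finally have split: "integral {0..1} (\<lambda>y. p y *\<^sub>R G1 t y + (1 - p y) *\<^sub>R G2 t y)
      = integral {0..1} ?G + integral {0..1} (G2 t)" .
  have coef: "frac_kernel b t * (t / b) = t powr b / Gamma (b + 1)"
    using t b Gamma_real_plus1[OF b] by (simp add: frac_kernel_def powr_diff)
  have "frac_conv b q A' t = (t powr b / Gamma (b + 1)) *\<^sub>R integral {0..1} (G2 t)"
    unfolding frac_conv_def G2_def p_def ..
  then have "(t powr b / Gamma (b + 1)) *\<^sub>R integral {0..1} (\<lambda>y. p y *\<^sub>R G1 t y + (1 - p y) *\<^sub>R G2 t y)
      + frac_kernel b t *\<^sub>R integral {0..1} (F t) = (frac_kernel b t * q t) *\<^sub>R A 0 + frac_conv b q A' t"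
    unfolding split key by (simp add: scaleR_diff_right scaleR_add_right coef[symmetric])
  with der show ?thesis by simp
qed

text \<open>Undoing the substitution: \<open>y = (1 - s / t) powr b\<close> corresponds to \<open>r = t - s\<close>. Stopping at \<open>x < t\<close>
keeps the kernel bounded.\<close>

lemma frac_kernel_convolution_has_integral:
  fixes v :: "real \<Rightarrow> 'a::banach"
  assumes b: "0 < b" and v: "continuous_on {0..} v" and x: "0 \<le> x" "x < t"
  shows "((\<lambda>s. frac_kernel b (t - s) *\<^sub>R v s) has_integral
    frac_conv b (\<lambda>_. 1) v t - (t powr b / Gamma (b + 1)) *\<^sub>R
      integral {0..(1 - x / t) powr b} (\<lambda>y. v (t * (1 - y powr (1 / b))))) {0..x}"
proof -
  have t: "0 < t" using x by simp
  define g where "g y = v (t * (1 - y powr (1 / b)))" for y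
  define H where "H z = integral {0..z} g" for z
  define P where "P s = - ((t powr b / Gamma (b + 1)) *\<^sub>R H ((1 - s / t) powr b))" for s
  have g: "continuous_on {0..1} g"
    using continuous_on_frac_conv_integrand'[of b "\<lambda>_. 1" v t] b v t unfolding g_def by simp
  have z: "(1 - s / t) powr b \<in> {0..1}" if "s \<in> {0..x}" for s
    using that x t b by (auto intro!: powr_unit_interval)
  have "((\<lambda>s. frac_kernel b (t - s) *\<^sub>R v s) has_integral P x - P 0) {0..x}"
  proof (rule fundamental_theorem_of_calculus_interior[OF x(1)])
    have "continuous_on {0..1} H"
      unfolding H_def by (intro indefinite_integral_continuous_1 integrable_continuous_real g)
    moreover have "continuous_on {0..x} (\<lambda>s. (1 - s / t) powr b)"
      using x t b by (intro continuous_on_powr' continuous_intros) auto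
    ultimately have "continuous_on {0..x} (\<lambda>s. H ((1 - s / t) powr b))"
      by (rule continuous_on_compose2) (use z in auto)
    then show "continuous_on {0..x} P"
      unfolding P_def by (intro continuous_intros)
    fix s assume s: "s \<in> {0<..<x}"
    define w where "w = (1 - s / t) powr b"
    have pos: "0 < 1 - s / t" "1 - s / t < 1" using s x t by auto
    have w: "0 < w" "w < 1"
      using pos b powr_less_mono2[of b "1 - s / t" 1] by (auto simp: w_def)
    have "(H has_vector_derivative g w) (at w within {0..1})"
      unfolding H_def using w by (intro integral_has_vector_derivative g) auto
    then have "(H has_vector_derivative g w) (at w)"
      using w at_within_interior[of w "{0..1}"] by simp
    moreover have "((\<lambda>s. (1 - s / t) powr b) has_vector_derivative - (b * (1 - s / t) powr (b - 1) / t)) (at s)"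
      unfolding has_real_derivative_iff_has_vector_derivative[symmetric]
      using pos t by (auto intro!: derivative_eq_intros)
    ultimately have "((H \<circ> (\<lambda>s. (1 - s / t) powr b)) has_vector_derivative
        (- (b * (1 - s / t) powr (b - 1) / t)) *\<^sub>R g w) (at s)"
      unfolding w_def by (intro vector_diff_chain_at)
    then have "(P has_vector_derivative
        - ((t powr b / Gamma (b + 1)) *\<^sub>R ((- (b * (1 - s / t) powr (b - 1) / t)) *\<^sub>R g w))) (at s)"
      unfolding P_def comp_def
      by (rule has_vector_derivative_minus[OF bounded_linear.has_vector_derivative[OF bounded_linear_scaleR_right]])
    moreover have "t powr b / Gamma (b + 1) * (b * (1 - s / t) powr (b - 1) / t) = frac_kernel b (t - s)"
    proof -
      have "(t - s) powr (b - 1) = (t * (1 - s / t)) powr (b - 1)"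
        using t by (simp add: algebra_simps)
      also have "\<dots> = t powr (b - 1) * (1 - s / t) powr (b - 1)"
        by (rule powr_mult)
      also have "t powr (b - 1) = t powr b / t"
        using t by (simp add: powr_diff)
      finally show ?thesis
        using b t Gamma_real_plus1[OF b] by (simp add: frac_kernel_def divide_simps)
    qed
    moreover have "g w = v s"
      using b pos t by (simp add: g_def w_def powr_powr algebra_simps)
    ultimately show "(P has_vector_derivative frac_kernel b (t - s) *\<^sub>R v s) (at s)"
      by simp
  qed
  moreover have "P x - P 0 = frac_conv b (\<lambda>_. 1) v t - (t powr b / Gamma (b + 1)) *\<^sub>R H ((1 - x / t) powr b)"
    using t unfolding frac_conv_def P_def H_def g_def by simp
  ultimately show ?thesis unfolding H_def g_def by simp
qed

text \<open>The derivative of the Poisson kernel, with the convention \<open>p\<^sub>n = 0\<close> for \<open>n < 0\<close>.\<close>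

definition poisson_kernel_deriv :: "nat \<Rightarrow> real \<Rightarrow> real" where
  "poisson_kernel_deriv n t = (if n = 0 then 0 else poisson_kernel (n - 1) t) - poisson_kernel n t"

lemma poisson_kernel_nonneg: "0 \<le> t \<Longrightarrow> 0 \<le> poisson_kernel n t"
  by (simp add: poisson_kernel_def)

lemma continuous_on_poisson_kernel [continuous_intros]: "continuous_on S (poisson_kernel n)"
  unfolding poisson_kernel_def by (intro continuous_intros) auto

lemma continuous_on_poisson_kernel_deriv: "continuous_on S (poisson_kernel_deriv n)"
  unfolding poisson_kernel_deriv_def by (cases "n = 0") (auto intro!: continuous_intros)

lemma poisson_kernel_has_derivative:
  "(poisson_kernel n has_real_derivative poisson_kernel_deriv n t) (at t within S)"
proof -
  have "(poisson_kernel n has_real_derivative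
      exp (- t) * (real n * t ^ (n - 1)) / fact n - exp (- t) * t ^ n / fact n) (at t within S)"
    unfolding poisson_kernel_def by (auto intro!: derivative_eq_intros simp: field_simps)
  moreover have "exp (- t) * (real n * t ^ (n - 1)) / fact n = (if n = 0 then 0 else poisson_kernel (n - 1) t)"
  proof (cases n)
    case (Suc k)
    have "exp (- t) * (real (Suc k) * t ^ k) / fact (Suc k) = exp (- t) * t ^ k * (real (Suc k) / fact (Suc k))"
      by (simp del: fact_Suc)
    also have "real (Suc k) / fact (Suc k) = 1 / (fact k :: real)"
      by simp
    finally show ?thesis by (simp add: Suc poisson_kernel_def del: fact_Suc of_nat_Suc)
  qed simp
  ultimately show ?thesis
    by (simp add: poisson_kernel_deriv_def poisson_kernel_def)
qed

lemma poisson_kernel_add: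
  "poisson_kernel n (r + s) = (\<Sum>j\<le>n. poisson_kernel (n - j) r * poisson_kernel j s)"
proof -
  have "(r + s) ^ n / fact n = (\<Sum>j\<le>n. s ^ j / fact j * (r ^ (n - j) / fact (n - j)))"
    unfolding add.commute[of r s] binomial_ring sum_divide_distrib
    by (intro sum.cong) (auto simp: binomial_fact)
  then have "poisson_kernel n (r + s) = exp (- r) * exp (- s) * (\<Sum>j\<le>n. s ^ j / fact j * (r ^ (n - j) / fact (n - j)))"
    by (simp add: poisson_kernel_def exp_diff exp_minus divide_simps)
  then show ?thesis
    by (simp add: poisson_kernel_def sum_distrib_left mult_ac)
qed

text \<open>The right-hand side \<open>R\<close> is what Fubini's theorem would give. Both sides vanish at \<open>T = 0\<close>. The
antiderivatives of \<open>p\<^sub>j v\<close> vanish at \<open>0\<close>, so the product rule leaves in \<open>R'\<close> only the sum of the convolutions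
of \<open>g\<^sub>b p\<^sub>n\<^sub>-\<^sub>j\<close> with \<open>p\<^sub>j v\<close>, which the addition formula collapses to \<open>p\<^sub>n * (g\<^sub>b * v)\<close>.\<close>

lemma poisson_kernel_frac_conv_has_integral:
  fixes v :: "real \<Rightarrow> 'a::banach"
  assumes b: "0 < b" and v: "continuous_on {0..} v" and T: "0 \<le> T"
  shows "((\<lambda>t. poisson_kernel n t *\<^sub>R frac_conv b (\<lambda>_. 1) v t) has_integral
    (\<Sum>j\<le>n. frac_conv b (poisson_kernel (n - j)) (\<lambda>s. integral {0..s} (\<lambda>r. poisson_kernel j r *\<^sub>R v r)) T))
    {0..T}"
proof -
  define A where "A j s = integral {0..s} (\<lambda>r. poisson_kernel j r *\<^sub>R v r)" for j s
  define R where "R t = (\<Sum>j\<le>n. frac_conv b (poisson_kernel (n - j)) (A j) t)" for t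
  have pv: "continuous_on {0..} (\<lambda>r. poisson_kernel j r *\<^sub>R v r)" for j
    by (intro continuous_intros v)
  have dA: "(A j has_vector_derivative poisson_kernel j s *\<^sub>R v s) (at s within {0..})" if "0 \<le> s" for j s
    unfolding A_def by (rule integral_has_vector_derivative_nonneg[OF pv that])
  have A: "continuous_on {0..} (A j)" for j
    using dA by (intro continuous_on_vector_derivative) auto
  have "((\<lambda>t. poisson_kernel n t *\<^sub>R frac_conv b (\<lambda>_. 1) v t) has_integral R T - R 0) {0..T}"
  proof (rule fundamental_theorem_of_calculus_interior[OF T])
    show "continuous_on {0..T} R"
      unfolding R_def using T
      by (intro continuous_on_sum continuous_on_subset[OF continuous_on_frac_conv] b A continuous_intros) auto
    fix t assume "t \<in> {0<..<T}"
    then have t: "0 < t" by simp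
    have "(frac_conv b (poisson_kernel k) (A j) has_vector_derivative
        (frac_kernel b t * poisson_kernel k t) *\<^sub>R A j 0 +
        frac_conv b (poisson_kernel k) (\<lambda>s. poisson_kernel j s *\<^sub>R v s) t) (at t)" for j k
      by (intro frac_conv_has_vector_derivative[where q' = "poisson_kernel_deriv k"]
          b t dA pv poisson_kernel_has_derivative continuous_on_poisson_kernel_deriv)
    then have "(R has_vector_derivative (\<Sum>j\<le>n. (frac_kernel b t * poisson_kernel (n - j) t) *\<^sub>R A j 0 +
        frac_conv b (poisson_kernel (n - j)) (\<lambda>s. poisson_kernel j s *\<^sub>R v s) t)) (at t)"
      unfolding R_def by (intro has_vector_derivative_sum)
    moreover have "(\<Sum>j\<le>n. frac_conv b (poisson_kernel (n - j)) (\<lambda>s. poisson_kernel j s *\<^sub>R v s) t)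
        = poisson_kernel n t *\<^sub>R frac_conv b (\<lambda>_. 1) v t"
    proof -
      let ?p = "\<lambda>y. y powr (1 / b)"
      have "(\<Sum>j\<le>n. integral {0..1} (\<lambda>y. poisson_kernel (n - j) (t * ?p y) *\<^sub>R
            poisson_kernel j (t * (1 - ?p y)) *\<^sub>R v (t * (1 - ?p y))))
          = integral {0..1} (\<lambda>y. \<Sum>j\<le>n. poisson_kernel (n - j) (t * ?p y) *\<^sub>R
            poisson_kernel j (t * (1 - ?p y)) *\<^sub>R v (t * (1 - ?p y)))"
        using t by (intro integral_sum[symmetric] integrable_frac_conv_integrand b pv continuous_intros) auto
      also have "\<dots> = integral {0..1} (\<lambda>y. poisson_kernel n t *\<^sub>R v (t * (1 - ?p y)))"
      proof (rule integral_cong)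
        fix y
        have "(\<Sum>j\<le>n. poisson_kernel (n - j) (t * ?p y) * poisson_kernel j (t * (1 - ?p y))) = poisson_kernel n t"
          by (subst poisson_kernel_add[symmetric]) (simp add: algebra_simps)
        then show "(\<Sum>j\<le>n. poisson_kernel (n - j) (t * ?p y) *\<^sub>R poisson_kernel j (t * (1 - ?p y)) *\<^sub>R v (t * (1 - ?p y)))
            = poisson_kernel n t *\<^sub>R v (t * (1 - ?p y))"
          by (simp add: scaleR_sum_left[symmetric])
      qed
      finally show ?thesis
        unfolding frac_conv_def by (simp add: scaleR_sum_right[symmetric] mult.commute)
    qed
    ultimately show "(R has_vector_derivative poisson_kernel n t *\<^sub>R frac_conv b (\<lambda>_. 1) v t) (at t)"
      by (simp add: A_def)
  qed
  then show ?thesis unfolding R_def A_def by simp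
qed

text \<open>The arguments of the two factors of the integrand always add up to \<open>t\<close>, which is why the estimate is
required only for \<open>r + s = t\<close>.\<close>

lemma frac_conv_norm_le:
  fixes v :: "real \<Rightarrow> 'a::banach" and w :: "real \<Rightarrow> real"
  assumes b: "0 < b" and t: "0 \<le> t"
    and c: "continuous_on {0..} q" "continuous_on {0..} v" "continuous_on {0..} q2" "continuous_on {0..} w"
    and le: "\<And>r s. 0 \<le> r \<Longrightarrow> 0 \<le> s \<Longrightarrow> r + s = t \<Longrightarrow> norm (q r *\<^sub>R v s) \<le> q2 r * w s"
  shows "norm (frac_conv b q v t) \<le> frac_conv b q2 w t"
proof -
  let ?p = "\<lambda>y. y powr (1 / b)"
  have "norm (integral {0..1} (\<lambda>y. q (t * ?p y) *\<^sub>R v (t * (1 - ?p y))))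
      \<le> integral {0..1} (\<lambda>y. q2 (t * ?p y) *\<^sub>R w (t * (1 - ?p y)))"
  proof (rule integral_norm_bound_integral)
    fix y :: real assume "y \<in> {0..1}"
    then have "?p y \<le> 1" using b by (auto intro: powr_unit_interval)
    then show "norm (q (t * ?p y) *\<^sub>R v (t * (1 - ?p y))) \<le> q2 (t * ?p y) *\<^sub>R w (t * (1 - ?p y))"
      unfolding real_scaleR_def using t mult_left_mono[of "?p y" 1 t] by (intro le) (auto simp: algebra_simps)
  qed (intro integrable_frac_conv_integrand b t c)+
  moreover have "0 \<le> t powr b / Gamma (b + 1)"
    using b Gamma_real_pos[of "b + 1"] by (auto intro!: divide_nonneg_nonneg less_imp_le)
  ultimately show ?thesis
    unfolding frac_conv_def norm_scaleR real_scaleR_def by (simp only: abs_of_nonneg mult_left_mono)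
qed

lemma frac_conv_const:
  fixes x :: "'a::banach"
  assumes b: "0 < b" and t: "0 \<le> t" and q: "continuous_on {0..} q"
  shows "frac_conv b q (\<lambda>_. x) t = frac_conv b q (\<lambda>_. 1::real) t *\<^sub>R x"
proof -
  have "(\<lambda>y. q (t * y powr (1 / b))) integrable_on {0..1}"
    using integrable_frac_conv_integrand[OF b q _ t, of "\<lambda>_. 1::real"] by simp
  then have "integral {0..1} (\<lambda>y. q (t * y powr (1 / b)) *\<^sub>R x) = integral {0..1} (\<lambda>y. q (t * y powr (1 / b))) *\<^sub>R x"
    by (intro integral_unique has_integral_scaleR_left integrable_integral)
  then show ?thesis by (simp add: frac_conv_def)
qed

lemma frac_conv_add:
  fixes v w :: "real \<Rightarrow> 'a::banach"
  assumes b: "0 < b" and t: "0 \<le> t" and q: "continuous_on {0..} q"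
    and v: "continuous_on {0..} v" and w: "continuous_on {0..} w"
  shows "frac_conv b q (\<lambda>s. v s + w s) t = frac_conv b q v t + frac_conv b q w t"
  unfolding frac_conv_def scaleR_add_right
  by (subst integral_add) (intro integrable_frac_conv_integrand assms | simp add: scaleR_add_right)+

lemma frac_conv_1_1: "frac_conv b (\<lambda>_. 1) (\<lambda>_. 1::real) t = t powr b / Gamma (b + 1)"
  by (simp add: frac_conv_def)

lemma frac_conv_norm_le_const:
  fixes v :: "real \<Rightarrow> 'a::banach"
  assumes b: "0 < b" and t: "0 \<le> t" and c: "continuous_on {0..} q" "continuous_on {0..} v"
    and le: "\<And>r s. 0 \<le> r \<Longrightarrow> 0 \<le> s \<Longrightarrow> r + s = t \<Longrightarrow> norm (q r *\<^sub>R v s) \<le> M"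
  shows "norm (frac_conv b q v t) \<le> t powr b / Gamma (b + 1) * M"
proof -
  have "norm (frac_conv b q v t) \<le> frac_conv b (\<lambda>_. 1) (\<lambda>_. M) t"
    using le by (intro frac_conv_norm_le b t c) auto
  then show ?thesis using frac_conv_const[OF b t, of "\<lambda>_. 1" M] by (simp add: frac_conv_1_1)
qed

section \<open>Limits at infinity and Cesaro numbers\<close>

lemma has_integral_atLeast_tendsto:
  fixes f :: "real \<Rightarrow> 'a::banach"
  assumes I: "(f has_integral I) {0..}" and G: "\<And>T. 0 \<le> T \<Longrightarrow> (f has_integral G T) {0..T}"
  shows "(G \<longlongrightarrow> I) at_top"
proof (rule tendstoI)
  fix e :: real assume e: "0 < e"
  have "\<nexists>a b. {0::real..} = cbox a b"
  proof (intro notI, elim exE)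
    fix a b :: real assume eq: "{0..} = cbox a b"
    have "max b 0 + 1 \<in> {0..}" by simp
    then have "max b 0 + 1 \<le> b" unfolding eq by simp
    then show False by linarith
  qed
  then obtain B where B: "0 < B" "\<And>a b. ball 0 B \<subseteq> cbox a b \<Longrightarrow>
      \<exists>z. ((\<lambda>x. if x \<in> {0..} then f x else 0) has_integral z) (cbox a b) \<and> norm (z - I) < e"
    using has_integral_altD[OF I _ e] by metis
  show "\<forall>\<^sub>F T in at_top. dist (G T) I < e"
    using eventually_ge_at_top[of B]
  proof eventually_elim
    case (elim T)
    then have "ball 0 B \<subseteq> cbox (- T) T" by (auto simp: dist_real_def)
    from B(2)[OF this] obtain z where
      z: "((\<lambda>x. if x \<in> {0..} then f x else 0) has_integral z) {- T..T}" "norm (z - I) < e"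
      by auto
    have "((\<lambda>x. if x \<in> {0..T} then f x else 0) has_integral G T) {- T..T}"
      using G[of T] B(1) elim by (subst has_integral_restrict) auto
    then have "((\<lambda>x. if x \<in> {0..} then f x else 0) has_integral G T) {- T..T}"
      by (rule has_integral_eq[rotated]) auto
    then have "z = G T" using z(1) by (rule has_integral_unique[symmetric])
    then show ?case using z(2) by (simp add: dist_norm)
  qed
qed

lemma frac_conv_poisson_kernel_has_integral:
  assumes b: "0 < b" and T: "0 \<le> T"
  shows "((\<lambda>t. frac_kernel b t * poisson_kernel k t) has_integral
    frac_conv b (poisson_kernel k) (\<lambda>_. 1::real) T) {0..T}"
proof -
  have "((\<lambda>t. frac_kernel b t * poisson_kernel k t) has_integral
    frac_conv b (poisson_kernel k) (\<lambda>_. 1::real) T - frac_conv b (poisson_kernel k) (\<lambda>_. 1::real) 0) {0..T}"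
  proof (rule fundamental_theorem_of_calculus_interior[OF T])
    show "continuous_on {0..T} (frac_conv b (poisson_kernel k) (\<lambda>_. 1::real))"
      by (rule continuous_on_subset[OF continuous_on_frac_conv]) (auto intro!: b continuous_intros)
    fix t assume t: "t \<in> {0<..<T}"
    have "(frac_conv b (poisson_kernel k) (\<lambda>_. 1::real) has_vector_derivative
        (frac_kernel b t * poisson_kernel k t) *\<^sub>R 1 + frac_conv b (poisson_kernel k) (\<lambda>_. 0) t) (at t)"
      using t by (intro frac_conv_has_vector_derivative[where q' = "poisson_kernel_deriv k"]
          b poisson_kernel_has_derivative continuous_on_poisson_kernel_deriv) auto
    then show "(frac_conv b (poisson_kernel k) (\<lambda>_. 1::real) has_vector_derivative
        frac_kernel b t * poisson_kernel k t) (at t)"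
      by (simp add: frac_conv_def)
  qed
  then show ?thesis by simp
qed

text \<open>Euler's integral for \<open>Gamma (b + k)\<close>.\<close>

lemma frac_kernel_poisson_kernel_has_integral:
  assumes b: "0 < b"
  shows "((\<lambda>t. frac_kernel b t * poisson_kernel k t) has_integral cesaro b k) {0..}"
proof -
  have "((\<lambda>t. t powr (b + real k - 1) / exp t * (1 / (Gamma b * fact k))) has_integral
      Gamma (b + real k) * (1 / (Gamma b * fact k))) {0..}"
    using b by (intro has_integral_mult_left Gamma_integral_real) auto
  moreover have "Gamma (real k + 1) = fact k"
    using Gamma_fact[of k, where 'a = real] by (simp add: add.commute)
  ultimately have "((\<lambda>t. t powr (b + real k - 1) / exp t * (1 / (Gamma b * fact k))) has_integral cesaro b k) {0..}"
    by (simp add: cesaro_def)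
  then show ?thesis
  proof (rule has_integral_eq[rotated])
    fix t :: real assume "t \<in> {0..}"
    then consider "t = 0" | "0 < t" by fastforce
    then show "t powr (b + real k - 1) / exp t * (1 / (Gamma b * fact k)) = frac_kernel b t * poisson_kernel k t"
    proof cases
      case 2
      then have "t powr (b + real k - 1) = t powr (b - 1) * t ^ k"
        by (simp add: powr_add[symmetric] powr_realpow[symmetric] algebra_simps)
      then show ?thesis by (simp add: frac_kernel_def poisson_kernel_def exp_minus divide_simps)
    qed (simp add: frac_kernel_def)
  qed
qed

lemma frac_conv_poisson_kernel_tendsto:
  assumes "0 < b"
  shows "(frac_conv b (poisson_kernel k) (\<lambda>_. 1::real) \<longlongrightarrow> cesaro b k) at_top"
  by (intro has_integral_atLeast_tendsto[OF frac_kernel_poisson_kernel_has_integral]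
      frac_conv_poisson_kernel_has_integral assms)

lemma frac_conv_poisson_kernel_le:
  assumes b: "0 < b" and T: "0 \<le> T"
  shows "frac_conv b (poisson_kernel k) (\<lambda>_. 1::real) T \<le> cesaro b k"
proof (rule has_integral_subset_le)
  show "((\<lambda>t. frac_kernel b t * poisson_kernel k t) has_integral
    frac_conv b (poisson_kernel k) (\<lambda>_. 1::real) T) {0..T}"
    by (rule frac_conv_poisson_kernel_has_integral[OF assms])
  show "((\<lambda>t. frac_kernel b t * poisson_kernel k t) has_integral cesaro b k) {0..}"
    by (rule frac_kernel_poisson_kernel_has_integral[OF b])
  show "\<forall>t\<in>{0..}. 0 \<le> frac_kernel b t * poisson_kernel k t"
    using Gamma_real_pos[OF b] by (simp add: frac_kernel_def poisson_kernel_nonneg)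
qed auto

lemma power_div_fact_le_exp:
  assumes "0 \<le> (x::real)"
  shows "x ^ n / fact n \<le> exp x"
proof -
  have "(\<Sum>k\<in>{n}. x ^ k /\<^sub>R fact k) \<le> (\<Sum>k. x ^ k /\<^sub>R fact k)"
    using assms by (intro sum_le_suminf summable_exp_generic) auto
  then show ?thesis by (simp add: exp_def divide_inverse mult.commute)
qed

text \<open>Trading a part \<open>exp (- c * s)\<close> of the decay for the power, by \<open>(c * s) ^ n / fact n \<le> exp (c * s)\<close>.\<close>

lemma poisson_kernel_le_exp:
  assumes c: "0 < c" and s: "0 \<le> s"
  shows "poisson_kernel n s \<le> (1 / c) ^ n * exp (- ((1 - c) * s))"
proof -
  have "poisson_kernel n s = (1 / c) ^ n * exp (- s) * ((c * s) ^ n / fact n)"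
    using c by (simp add: poisson_kernel_def power_mult_distrib power_one_over)
  also have "\<dots> \<le> (1 / c) ^ n * exp (- s) * exp (c * s)"
    using c s by (intro mult_left_mono power_div_fact_le_exp) auto
  also have "\<dots> = (1 / c) ^ n * exp (- ((1 - c) * s))"
    by (simp add: mult.assoc exp_add[symmetric] algebra_simps)
  finally show ?thesis .
qed

lemma poisson_kernel_le_1: "0 \<le> s \<Longrightarrow> poisson_kernel n s \<le> 1"
  using poisson_kernel_le_exp[of 1 s n] by simp

lemma integral_exp_decay:
  assumes c: "0 < c" and ab: "a \<le> b"
  shows "((\<lambda>s::real. K * exp (- (c * s))) has_integral K / c * exp (- (c * a)) - K / c * exp (- (c * b))) {a..b}"
proof -
  have "((\<lambda>s. K * exp (- (c * s))) has_integral (- (K / c * exp (- (c * b)))) - (- (K / c * exp (- (c * a))))) {a..b}"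
    using c ab by (intro fundamental_theorem_of_calculus[where f = "\<lambda>s. - (K / c * exp (- (c * s)))"])
      (auto intro!: derivative_eq_intros simp: has_real_derivative_iff_has_vector_derivative[symmetric])
  then show ?thesis by simp
qed

lemma exp_decay_tendsto: "0 < c \<Longrightarrow> ((\<lambda>t::real. exp (- (c * t))) \<longlongrightarrow> 0) at_top"
  by (intro filterlim_compose[OF exp_at_bot] filterlim_uminus_at_top[THEN iffD1]
      filterlim_tendsto_pos_mult_at_top[OF tendsto_const _ filterlim_ident])

lemma powr_le_exp:
  assumes a: "0 \<le> a" and c: "0 < (c::real)"
  obtains C where "0 \<le> C" and "\<And>t. 0 \<le> t \<Longrightarrow> t powr a \<le> C * exp (c * t)"
proof
  let ?n = "nat \<lceil>a\<rceil>"
  show "0 \<le> 1 + fact ?n / c ^ ?n" using c by simp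
  fix t :: real assume t: "0 \<le> t"
  have e1: "1 \<le> exp (c * t)" using c t by simp
  have "(c * t) ^ ?n / fact ?n \<le> exp (c * t)"
    using c t by (intro power_div_fact_le_exp) auto
  then have tn: "t ^ ?n \<le> fact ?n / c ^ ?n * exp (c * t)"
    using c by (simp add: power_mult_distrib field_simps)
  show "t powr a \<le> (1 + fact ?n / c ^ ?n) * exp (c * t)"
  proof (cases "t \<le> 1")
    case True
    then have "t powr a \<le> 1" using powr_mono2[of a t 1] a t by simp
    moreover have "0 \<le> fact ?n / c ^ ?n * exp (c * t)" using c by simp
    ultimately show ?thesis using e1 unfolding distrib_right by linarith
  next
    case False
    then have "t powr a \<le> t powr real ?n" by (intro powr_mono) linarith+
    also have "\<dots> = t ^ ?n" using False by (simp add: powr_realpow)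
    finally show ?thesis using tn e1 unfolding distrib_right by linarith
  qed
qed

lemma exp_decay_integral_converges:
  fixes f :: "real \<Rightarrow> 'a::banach"
  assumes c: "0 < c" and f: "continuous_on {0..} f"
    and le: "\<And>s. 0 \<le> s \<Longrightarrow> norm (f s) \<le> K * exp (- (c * s))"
  obtains L where "\<And>T. 0 \<le> T \<Longrightarrow> norm (integral {0..T} f - L) \<le> K / c * exp (- (c * T))"
proof -
  have K: "0 \<le> K" using order_trans[OF norm_ge_zero le[of 0]] by simp
  have int: "f integrable_on {x..y}" if "0 \<le> x" for x y
    using that by (intro integrable_continuous_real continuous_on_subset[OF f]) auto
  have diff: "norm (integral {0..T} f - integral {0..U} f) \<le> K / c * exp (- (c * T))" if "0 \<le> T" "T \<le> U" for T U
  proof -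
    have "integral {0..U} f - integral {0..T} f = integral {T..U} f"
      using Henstock_Kurzweil_Integration.integral_combine[OF that int[of 0 U, OF order_refl]] by (simp add: algebra_simps)
    also have "norm \<dots> \<le> integral {T..U} (\<lambda>s. K * exp (- (c * s)))"
      using that by (intro integral_norm_bound_integral int le integrable_continuous_real continuous_intros) auto
    also have "\<dots> = K / c * exp (- (c * T)) - K / c * exp (- (c * U))"
      using that c by (intro integral_unique integral_exp_decay) auto
    also have "\<dots> \<le> K / c * exp (- (c * T))" using c K by simp
    finally show ?thesis by (simp add: norm_minus_commute)
  qed
  have lim0: "((\<lambda>T. K / c * exp (- (c * T))) \<longlongrightarrow> 0) at_top"
    using tendsto_mult_right_zero[OF exp_decay_tendsto[OF c], of "K / c"] by simp
  have "Cauchy (\<lambda>n. integral {0..real n} f)"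
  proof (rule CauchyI')
    fix e :: real assume "0 < e"
    then have "\<forall>\<^sub>F n in sequentially. K / c * exp (- (c * real n)) < e"
      using filterlim_compose[OF lim0 filterlim_real_sequentially] by (auto dest!: order_tendstoD(2))
    then obtain N where N: "\<And>n. N \<le> n \<Longrightarrow> K / c * exp (- (c * real n)) < e"
      by (auto simp: eventually_sequentially)
    show "\<exists>M. \<forall>m\<ge>M. \<forall>n>m. dist (integral {0..real m} f) (integral {0..real n} f) < e"
    proof (intro exI[of _ N] allI impI)
      fix m n assume "N \<le> m" "m < n"
      then show "dist (integral {0..real m} f) (integral {0..real n} f) < e"
        unfolding dist_norm by (intro le_less_trans[OF diff N]) auto
    qed
  qed
  then obtain L where L: "(\<lambda>n. integral {0..real n} f) \<longlonglongrightarrow> L"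
    by (auto simp: Cauchy_convergent_iff convergent_def)
  show thesis
  proof (rule that)
    fix T :: real assume T: "0 \<le> T"
    have "(\<lambda>n. norm (integral {0..T} f - integral {0..real n} f)) \<longlonglongrightarrow> norm (integral {0..T} f - L)"
      by (intro tendsto_intros L)
    moreover have "\<forall>\<^sub>F n in sequentially. norm (integral {0..T} f - integral {0..real n} f) \<le> K / c * exp (- (c * T))"
      using eventually_ge_at_top[of "nat \<lceil>T\<rceil>"] by eventually_elim (rule diff[OF T], linarith)
    ultimately show "norm (integral {0..T} f - L) \<le> K / c * exp (- (c * T))"
      by (rule tendsto_upperbound) simp
  qed
qed

text \<open>For a constant \<open>A = L\<close> this is the definition of the Cesaro number as an integral. The remainder
\<open>A - L\<close> decays like \<open>exp (- s / 2)\<close> and \<open>p\<^sub>k r\<close> is at most a multiple of \<open>exp (- r / 2)\<close>, so with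
\<open>r + s = t\<close> their convolution is at most a multiple of \<open>t powr b * exp (- t / 2)\<close>.\<close>

lemma frac_conv_poisson_kernel_limit:
  fixes A :: "real \<Rightarrow> 'a::banach"
  assumes b: "0 < b" and A: "continuous_on {0..} A"
    and le: "\<And>s. 0 \<le> s \<Longrightarrow> norm (A s - L) \<le> K * exp (- (s / 2))"
  shows "(frac_conv b (poisson_kernel k) A \<longlongrightarrow> cesaro b k *\<^sub>R L) at_top"
proof -
  let ?p = "poisson_kernel k"
  have p: "continuous_on {0..} ?p" by (intro continuous_intros)
  have K: "0 \<le> K" using order_trans[OF norm_ge_zero le[of 0]] by simp
  have "((\<lambda>t. frac_conv b ?p (\<lambda>s. A s - L) t) \<longlongrightarrow> 0) at_top"
  proof (rule Lim_null_comparison)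
    show "\<forall>\<^sub>F t in at_top. norm (frac_conv b ?p (\<lambda>s. A s - L) t) \<le>
        t powr b / Gamma (b + 1) * (2 ^ k * K * exp (- (t / 2)))"
      using eventually_ge_at_top[of 0]
    proof eventually_elim
      case (elim t)
      show ?case
      proof (rule frac_conv_norm_le_const[OF b elim p])
        show "continuous_on {0..} (\<lambda>s. A s - L)" by (intro continuous_intros A)
        fix r s :: real assume rs: "0 \<le> r" "0 \<le> s" "r + s = t"
        have "norm (?p r *\<^sub>R (A s - L)) = ?p r * norm (A s - L)"
          using rs by (simp add: poisson_kernel_nonneg)
        also have "\<dots> \<le> (2 ^ k * exp (- (r / 2))) * (K * exp (- (s / 2)))"
          using rs poisson_kernel_le_exp[of "1/2" r k] by (intro mult_mono le) (auto intro: poisson_kernel_nonneg)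
        also have "\<dots> = 2 ^ k * K * (exp (- (r / 2)) * exp (- (s / 2)))" by simp
        also have "exp (- (r / 2)) * exp (- (s / 2)) = exp (- (t / 2))"
          using rs by (simp add: exp_add[symmetric] field_simps)
        finally show "norm (?p r *\<^sub>R (A s - L)) \<le> 2 ^ k * K * exp (- (t / 2))" .
      qed
    qed
    show "((\<lambda>t. t powr b / Gamma (b + 1) * (2 ^ k * K * exp (- (t / 2)))) \<longlongrightarrow> 0) at_top"
    proof -
      obtain C where C: "\<And>t. 0 \<le> t \<Longrightarrow> t powr b \<le> C * exp (1 / 4 * t)"
        using powr_le_exp[of b "1/4"] b by auto
      have "((\<lambda>t. t powr b * exp (- (t / 2))) \<longlongrightarrow> 0) at_top"
      proof (rule Lim_null_comparison)
        show "\<forall>\<^sub>F t in at_top. norm (t powr b * exp (- (t / 2))) \<le> C * exp (- (1 / 4 * t))"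
          using eventually_ge_at_top[of 0]
        proof eventually_elim
          case (elim t)
          have "t powr b * exp (- (t / 2)) \<le> C * exp (1 / 4 * t) * exp (- (t / 2))"
            by (intro mult_right_mono C elim) auto
          also have "\<dots> = C * exp (- (1 / 4 * t))" by (simp add: mult.assoc exp_add[symmetric])
          finally show ?case by simp
        qed
        show "((\<lambda>t. C * exp (- (1 / 4 * t))) \<longlongrightarrow> 0) at_top"
          by (intro tendsto_mult_right_zero exp_decay_tendsto) simp
      qed
      from tendsto_mult_right_zero[OF this, of "2 ^ k * K / Gamma (b + 1)"]
      show ?thesis by (simp add: mult_ac)
    qed
  qed
  moreover have "((\<lambda>t. frac_conv b ?p (\<lambda>_. 1::real) t *\<^sub>R L) \<longlongrightarrow> cesaro b k *\<^sub>R L) at_top"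
    by (intro tendsto_intros frac_conv_poisson_kernel_tendsto b)
  ultimately have "((\<lambda>t. frac_conv b ?p (\<lambda>s. A s - L) t + frac_conv b ?p (\<lambda>_. 1::real) t *\<^sub>R L)
      \<longlongrightarrow> 0 + cesaro b k *\<^sub>R L) at_top"
    by (rule tendsto_add)
  moreover have "\<forall>\<^sub>F t in at_top. frac_conv b ?p (\<lambda>s. A s - L) t + frac_conv b ?p (\<lambda>_. 1::real) t *\<^sub>R L = frac_conv b ?p A t"
    using eventually_ge_at_top[of 0]
  proof eventually_elim
    case (elim t)
    have "frac_conv b ?p (\<lambda>s. (A s - L) + L) t = frac_conv b ?p (\<lambda>s. A s - L) t + frac_conv b ?p (\<lambda>_. L) t"
      by (intro frac_conv_add b elim p continuous_intros A)
    then show ?case using frac_conv_const[OF b elim p, of L] by simp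
  qed
  ultimately show ?thesis by (auto elim: Lim_transform_eventually)
qed

section \<open>Integration by parts against the Poisson kernel\<close>

text \<open>The intervals that exhaust \<open>(0, \<infinity>)\<close>. They stay away from \<open>0\<close> because the fractional derivative is
in general unbounded there.\<close>

abbreviation window :: "nat \<Rightarrow> real set" where
  "window i \<equiv> {1 / (real i + 1)..real i + 1}"

lemma inverse_real_plus_1_tendsto: "(\<lambda>i. 1 / (real i + 1)) \<longlonglongrightarrow> 0"
  using LIMSEQ_inverse_real_of_nat by (simp add: inverse_eq_divide add.commute)

lemma real_plus_1_at_top: "filterlim (\<lambda>i. real i + 1) at_top sequentially"
  using filterlim_tendsto_add_at_top[OF tendsto_const[of 1] filterlim_real_sequentially]
  by (simp add: add.commute)

lemma window_subset: "window i \<subseteq> {0<..}"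
proof
  fix t assume "t \<in> window i"
  then have "1 / (real i + 1) \<le> t" by simp
  moreover have "0 < 1 / (real i + 1)" by simp
  ultimately show "t \<in> {0<..}" by (simp only: greaterThan_iff)
qed

lemma window_le: "1 / (real i + 1) \<le> real i + 1"
  by (simp add: divide_le_eq) (simp add: distrib_left distrib_right)

lemma integrable_on_window:
  fixes f :: "real \<Rightarrow> 'a::banach"
  shows "continuous_on {0<..} f \<Longrightarrow> f integrable_on window i"
  by (intro integrable_continuous_real continuous_on_subset[OF _ window_subset])

lemma integral_window_tendsto:
  fixes f :: "real \<Rightarrow> 'a::banach"
  assumes f: "continuous_on {0..} f" and G: "((\<lambda>T. integral {0..T} f) \<longlongrightarrow> L) at_top"
  shows "(\<lambda>i. integral (window i) f) \<longlonglongrightarrow> L"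
proof -
  let ?G = "\<lambda>T. integral {0..T} f"
  have "integral (window i) f = ?G (real i + 1) - ?G (1 / (real i + 1))" for i
  proof -
    have "f integrable_on {0..real i + 1}"
      by (intro integrable_continuous_real continuous_on_subset[OF f]) auto
    from Henstock_Kurzweil_Integration.integral_combine[OF _ window_le this]
    show ?thesis by (simp add: algebra_simps)
  qed
  moreover have "(\<lambda>i. ?G (1 / (real i + 1))) \<longlonglongrightarrow> ?G 0"
  proof -
    have "continuous_on {0..} ?G"
      using integral_has_vector_derivative_nonneg[OF f] by (intro continuous_on_vector_derivative) auto
    then show ?thesis
      by (rule continuous_on_tendsto_compose[OF _ inverse_real_plus_1_tendsto]) auto
  qed
  moreover have "(\<lambda>i. ?G (real i + 1)) \<longlonglongrightarrow> L"
    by (rule filterlim_compose[OF G real_plus_1_at_top])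
  ultimately show ?thesis using tendsto_diff[of _ L sequentially _ "?G 0"] by simp
qed

lemma has_bochner_window:
  fixes f :: "real \<Rightarrow> 'a::banach"
  assumes f: "continuous_on {0<..} f"
    and bound: "\<And>i. integral (window i) (\<lambda>t. norm (f t)) \<le> B"
    and lim: "(\<lambda>i. integral (window i) f) \<longlonglongrightarrow> I"
  shows "has_bochner {0..} f I"
proof (rule has_bochner_exhaustion[OF _ _ _ _ _ _ bound lim])
  show "window i \<subseteq> {0..}" for i using window_subset[of i] by auto
  show "decseq (\<lambda>i. 1 / (real i + 1))"
    by (auto simp: decseq_def intro!: divide_left_mono mult_pos_pos)
  show "incseq (\<lambda>i. real i + 1)" by (auto simp: incseq_def)
  show "continuous_on (window i) f" for i by (rule continuous_on_subset[OF f window_subset])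
  have "AE t in lebesgue. t \<noteq> (0::real)"
    by (rule AE_I'[of "{0}"]) auto
  then have "AE t in lebesgue_on {0..}. t \<noteq> (0::real)"
    by (auto simp: AE_restrict_space_iff elim: eventually_mono)
  moreover have "AE t in lebesgue_on {0..}. t \<in> {0::real..}"
    by (rule AE_I2) simp
  ultimately show "AE t in lebesgue_on {0..}. \<exists>i. t \<in> window i"
  proof eventually_elim
    case (elim t)
    then have t: "0 < t" by simp
    obtain i where "max t (1 / t) < real i" using reals_Archimedean2 by blast
    then have "t \<le> real i + 1" "1 / t \<le> real i + 1" by auto
    then have "t \<in> window i" using t by (auto simp: field_simps)
    then show ?case ..
  qed
qed auto

lemma integral_window_norm_le_exp:
  fixes f :: "real \<Rightarrow> 'a::banach"
  assumes c: "0 < c" and f: "continuous_on {0<..} f"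
    and le: "\<And>t. 0 < t \<Longrightarrow> norm (f t) \<le> K * exp (- (c * t))"
  shows "integral (window i) (\<lambda>t. norm (f t)) \<le> K / c"
proof -
  have K: "0 \<le> K" using order_trans[OF norm_ge_zero le[of 1]] by (simp add: zero_le_mult_iff)
  have "integral (window i) (\<lambda>t. norm (f t)) \<le> integral (window i) (\<lambda>t. K * exp (- (c * t)))"
    using window_subset[of i]
    by (intro integral_le integrable_on_window continuous_intros f le) auto
  also have "\<dots> = K / c * exp (- (c * (1 / (real i + 1)))) - K / c * exp (- (c * (real i + 1)))"
    by (intro integral_unique integral_exp_decay c window_le)
  also have "\<dots> \<le> K / c * exp (- (c * (1 / (real i + 1))))" using c K by simp
  also have "\<dots> \<le> K / c * 1" using c K by (intro mult_left_mono) auto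
  finally show ?thesis by simp
qed

text \<open>The factor \<open>t ^ N\<close> of the Poisson kernel absorbs a singularity of order \<open>k \<le> N\<close> at \<open>0\<close>, and of the
decay \<open>exp (- t)\<close> a quarter is spent on the remaining power and a half on the growth of \<open>x\<close>.\<close>

lemma norm_poisson_kernel_weight_le:
  fixes x :: "'a::real_normed_vector"
  assumes kN: "k \<le> N" and t: "0 < t" and x: "t ^ k * norm x \<le> C * exp (t / 2)"
  shows "norm (poisson_kernel N t *\<^sub>R x) \<le> 4 ^ (N - k) * C * exp (- (1 / 4 * t))"
proof -
  have "poisson_kernel N t \<le> poisson_kernel (N - k) t * t ^ k"
  proof -
    have "t ^ N = t ^ (N - k) * t ^ k" using kN by (simp add: power_add[symmetric])
    moreover have "exp (- t) * t ^ N / fact N \<le> exp (- t) * t ^ N / fact (N - k)"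
      using t by (intro divide_left_mono fact_mono) auto
    ultimately show ?thesis by (simp add: poisson_kernel_def)
  qed
  then have "norm (poisson_kernel N t *\<^sub>R x) \<le> poisson_kernel (N - k) t * (t ^ k * norm x)"
    using t poisson_kernel_nonneg[of t N] mult_right_mono[of _ _ "norm x"] by (simp add: mult.assoc[symmetric])
  also have "\<dots> \<le> (4 ^ (N - k) * exp (- (3 / 4 * t))) * (C * exp (t / 2))"
    using t x poisson_kernel_le_exp[of "1/4" t "N - k"]
    by (intro mult_mono[OF _ x]) (auto intro: mult_nonneg_nonneg)
  also have "\<dots> = 4 ^ (N - k) * C * (exp (- (3 / 4 * t)) * exp (t / 2))" by simp
  also have "exp (- (3 / 4 * t)) * exp (t / 2) = exp (- (1 / 4 * t))"
    by (simp add: exp_add[symmetric])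
  finally show ?thesis .
qed

lemma poisson_kernel_Suc_le:
  assumes "0 \<le> t" shows "poisson_kernel (Suc N) t \<le> t * poisson_kernel N t"
proof -
  have "poisson_kernel (Suc N) t = t * poisson_kernel N t / real (Suc N)"
    by (simp add: poisson_kernel_def mult_ac)
  also have "\<dots> \<le> t * poisson_kernel N t / 1"
    using assms by (intro divide_left_mono) (auto intro: mult_nonneg_nonneg poisson_kernel_nonneg)
  finally show ?thesis by simp
qed

text \<open>Here \<open>p\<^sub>N\<^sub>+\<^sub>1' = p\<^sub>N - p\<^sub>N\<^sub>+\<^sub>1\<close> enters. The boundary terms are at most a multiple of \<open>t * exp (- t / 4)\<close>,
since \<open>p\<^sub>N\<^sub>+\<^sub>1 t \<le> t * p\<^sub>N t\<close>, and so vanish at both ends.\<close>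

lemma poisson_integration_by_parts:
  fixes h :: "real \<Rightarrow> 'a::banach"
  assumes h: "\<And>t. 0 < t \<Longrightarrow> (h has_vector_derivative h' t) (at t)"
    and h': "continuous_on {0<..} h'"
    and kN: "k \<le> N" and bound: "\<And>t. 0 < t \<Longrightarrow> t ^ k * norm (h t) \<le> C * exp (t / 2)"
    and L0: "(\<lambda>i. integral (window i) (\<lambda>t. poisson_kernel N t *\<^sub>R h t)) \<longlonglongrightarrow> L0"
    and L1: "(\<lambda>i. integral (window i) (\<lambda>t. poisson_kernel (Suc N) t *\<^sub>R h t)) \<longlonglongrightarrow> L1"
  shows "(\<lambda>i. integral (window i) (\<lambda>t. poisson_kernel (Suc N) t *\<^sub>R h' t)) \<longlonglongrightarrow> L1 - L0"
proof -
  let ?p = "poisson_kernel"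
  let ?b = "\<lambda>t. ?p (Suc N) t *\<^sub>R h t"
  define D where "D = 4 ^ (N - k) * C"
  have hc: "continuous_on {0<..} h"
    by (rule continuous_on_vector_derivative) (use h has_vector_derivative_at_within in blast)
  have b_le: "norm (?b t) \<le> t * (D * exp (- (1 / 4 * t)))" if t: "0 < t" for t
  proof -
    have "norm (?b t) \<le> t * norm (?p N t *\<^sub>R h t)"
      using t mult_right_mono[OF poisson_kernel_Suc_le[of t N] norm_ge_zero[of "h t"]]
      by (simp add: poisson_kernel_nonneg mult.assoc)
    also have "\<dots> \<le> t * (D * exp (- (1 / 4 * t)))"
      unfolding D_def using t by (intro mult_left_mono norm_poisson_kernel_weight_le kN bound) auto
    finally show ?thesis .
  qed
  have D: "0 \<le> D"
    using order_trans[OF norm_ge_zero b_le[of 1]] by (simp add: zero_le_mult_iff)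
  have low: "(\<lambda>i. ?b (1 / (real i + 1))) \<longlonglongrightarrow> 0"
  proof (rule Lim_null_comparison[OF always_eventually])
    show "\<forall>i. norm (?b (1 / (real i + 1))) \<le> 1 / (real i + 1) * D"
    proof
      fix i
      let ?t = "1 / (real i + 1)"
      have t: "0 < ?t" by simp
      have "norm (?b ?t) \<le> ?t * (D * exp (- (1 / 4 * ?t)))" by (rule b_le[OF t])
      also have "\<dots> \<le> ?t * (D * 1)" using D t by (intro mult_left_mono) auto
      finally show "norm (?b ?t) \<le> ?t * D" by simp
    qed
    show "(\<lambda>i. 1 / (real i + 1) * D) \<longlonglongrightarrow> 0"
      using tendsto_mult_left_zero[OF inverse_real_plus_1_tendsto] .
  qed
  have high: "(\<lambda>i. ?b (real i + 1)) \<longlonglongrightarrow> 0"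
  proof (rule Lim_null_comparison[OF always_eventually])
    show "\<forall>i. norm (?b (real i + 1)) \<le> 8 * D * exp (- (1 / 8 * (real i + 1)))"
    proof
      fix i
      let ?t = "real i + 1"
      have le1: "norm (?b ?t) \<le> ?t * (D * exp (- (1 / 4 * ?t)))" by (rule b_le) simp
      \<comment> \<open>half of the remaining decay pays for the factor t\<close>
      have t8: "?t \<le> 8 * exp (1 / 8 * ?t)"
      proof -
        have "x \<le> exp x" for x :: real using exp_ge_add_one_self[of x] by linarith
        from mult_left_mono[OF this[of "1 / 8 * ?t"], of 8] show ?thesis
          by (simp only: mult.assoc[symmetric]) simp
      qed
      note le1
      also have "?t * (D * exp (- (1 / 4 * ?t))) \<le> (8 * exp (1 / 8 * ?t)) * (D * exp (- (1 / 4 * ?t)))"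
        using D by (intro mult_right_mono[OF t8]) auto
      also have "\<dots> = 8 * D * (exp (1 / 8 * ?t) * exp (- (1 / 4 * ?t)))" by simp
      also have "exp (1 / 8 * ?t) * exp (- (1 / 4 * ?t)) = exp (- (1 / 8 * ?t))"
        by (simp add: exp_add[symmetric])
      finally show "norm (?b ?t) \<le> 8 * D * exp (- (1 / 8 * ?t))" .
    qed
    show "(\<lambda>i. 8 * D * exp (- (1 / 8 * (real i + 1)))) \<longlonglongrightarrow> 0"
      by (intro tendsto_mult_right_zero filterlim_compose[OF exp_decay_tendsto real_plus_1_at_top]) simp
  qed
  have "integral (window i) (\<lambda>t. ?p (Suc N) t *\<^sub>R h' t) =
      integral (window i) (\<lambda>t. ?p (Suc N) t *\<^sub>R h t) - integral (window i) (\<lambda>t. ?p N t *\<^sub>R h t)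
      + (?b (real i + 1) - ?b (1 / (real i + 1)))" for i
  proof -
    have pos: "0 < t" if "t \<in> window i" for t using that window_subset[of i] by auto
    have "((\<lambda>t. ?p (Suc N) t *\<^sub>R h' t + (?p N t - ?p (Suc N) t) *\<^sub>R h t) has_integral
        ?b (real i + 1) - ?b (1 / (real i + 1))) (window i)"
    proof (rule fundamental_theorem_of_calculus[OF window_le])
      fix t assume "t \<in> window i"
      then have "(?b has_vector_derivative ?p (Suc N) t *\<^sub>R h' t + poisson_kernel_deriv (Suc N) t *\<^sub>R h t) (at t)"
        by (intro has_vector_derivative_scaleR poisson_kernel_has_derivative h pos)
      then show "(?b has_vector_derivative ?p (Suc N) t *\<^sub>R h' t + (?p N t - ?p (Suc N) t) *\<^sub>R h t)
          (at t within window i)"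
        by (simp add: poisson_kernel_deriv_def has_vector_derivative_at_within)
    qed
    then have "?b (real i + 1) - ?b (1 / (real i + 1)) =
        integral (window i) (\<lambda>t. ?p (Suc N) t *\<^sub>R h' t + (?p N t *\<^sub>R h t - ?p (Suc N) t *\<^sub>R h t))"
      by (simp add: scaleR_diff_left integral_unique[symmetric])
    also have "\<dots> = integral (window i) (\<lambda>t. ?p (Suc N) t *\<^sub>R h' t)
        + (integral (window i) (\<lambda>t. ?p N t *\<^sub>R h t) - integral (window i) (\<lambda>t. ?p (Suc N) t *\<^sub>R h t))"
      by (subst integral_add integral_diff,
          (intro integrable_on_window continuous_intros h' hc)+)+ simp
    finally show ?thesis by simp
  qed
  then show ?thesis
    using tendsto_add[OF tendsto_diff[OF L1 L0] tendsto_diff[OF high low]] by simp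
qed

text \<open>The singularity of \<open>h k\<close> at \<open>0\<close> may grow with \<open>k\<close>; the index \<open>n + k\<close> of the Poisson kernel grows with it.\<close>

lemma poisson_iterated_derivative:
  fixes h :: "nat \<Rightarrow> real \<Rightarrow> 'a::banach"
  assumes deriv: "\<And>k t. k < m \<Longrightarrow> 0 < t \<Longrightarrow> (h k has_vector_derivative h (Suc k) t) (at t)"
    and cont: "continuous_on {0<..} (h m)"
    and bound: "\<And>k. k < m \<Longrightarrow> \<exists>C. \<forall>t>0. t ^ k * norm (h k t) \<le> C * exp (t / 2)"
    and lim: "\<And>n. (\<lambda>i. integral (window i) (\<lambda>t. poisson_kernel n t *\<^sub>R h 0 t)) \<longlonglongrightarrow> L n"
    and "k \<le> m"
  shows "(\<lambda>i. integral (window i) (\<lambda>t. poisson_kernel (n + k) t *\<^sub>R h k t)) \<longlonglongrightarrow> (forward_diff ^^ k) L n"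
  using \<open>k \<le> m\<close>
proof (induction k arbitrary: n)
  case (Suc k)
  then have k: "k < m" by simp
  obtain C where C: "\<And>t. 0 < t \<Longrightarrow> t ^ k * norm (h k t) \<le> C * exp (t / 2)"
    using bound[OF k] by blast
  have "continuous_on {0<..} (h (Suc k))"
  proof (cases "Suc k = m")
    case False
    then have "Suc k < m" using k by simp
    then show ?thesis
      by (intro continuous_on_vector_derivative) (use deriv has_vector_derivative_at_within in blast)
  qed (use cont in simp)
  then have "(\<lambda>i. integral (window i) (\<lambda>t. poisson_kernel (Suc (n + k)) t *\<^sub>R h (Suc k) t))
      \<longlonglongrightarrow> (forward_diff ^^ k) L (Suc n) - (forward_diff ^^ k) L n"
    using Suc.IH[of n] Suc.IH[of "Suc n"] k deriv C
    by (intro poisson_integration_by_parts[where k = k and C = C and h = "h k"]) auto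
  then show ?case by (simp add: forward_diff_def[of "(forward_diff ^^ k) L"])
qed (use lim in simp)

section \<open>Derivatives of the fractional integral\<close>

text \<open>The \<open>i\<close>-th derivative of the fractional kernel on \<open>(0, \<infinity>)\<close>.\<close>

definition frac_kernel_deriv :: "real \<Rightarrow> nat \<Rightarrow> real \<Rightarrow> real" where
  "frac_kernel_deriv b i t = (\<Prod>l<i. b - 1 - real l) / Gamma b * t powr (b - 1 - real i)"

lemma frac_kernel_deriv_0: "frac_kernel_deriv b 0 t = frac_kernel b t"
  by (simp add: frac_kernel_deriv_def frac_kernel_def)

lemma frac_kernel_deriv_has_derivative:
  assumes "0 < t"
  shows "(frac_kernel_deriv b i has_real_derivative frac_kernel_deriv b (Suc i) t) (at t)"
proof -
  have "(frac_kernel_deriv b i has_real_derivative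
      (\<Prod>l<i. b - 1 - real l) / Gamma b * ((b - 1 - real i) * t powr (b - 1 - real i - 1))) (at t)"
    unfolding frac_kernel_deriv_def using assms
    by (intro DERIV_cmult has_real_derivative_powr)
  moreover have "b - 1 - real i - 1 = b - 1 - real (Suc i)" by simp
  ultimately show ?thesis
    by (simp only: frac_kernel_deriv_def lessThan_Suc prod.insert[OF finite_lessThan] lessThan_iff) (simp add: mult_ac)
qed

text \<open>The terms that the initial values \<open>c j\<close> of the derivatives of \<open>u\<close> contribute to the \<open>k\<close>-th derivative
of the fractional integral: differentiating \<open>g\<^sub>b * u\<^sup>(\<^sup>j\<^sup>)\<close> leaves \<open>g\<^sub>b c\<^sub>j\<close> behind, and the remaining
\<open>k - 1 - j\<close> differentiations act on that term.\<close>

definition RL_boundary :: "real \<Rightarrow> (nat \<Rightarrow> 'a::banach) \<Rightarrow> nat \<Rightarrow> real \<Rightarrow> 'a" where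
  "RL_boundary b c k t = (\<Sum>j<k. frac_kernel_deriv b (k - 1 - j) t *\<^sub>R c j)"

lemma RL_boundary_has_vector_derivative:
  assumes t: "0 < t"
  shows "(RL_boundary b c k has_vector_derivative RL_boundary b c (Suc k) t - frac_kernel b t *\<^sub>R c k) (at t)"
proof -
  have "((\<lambda>t. frac_kernel_deriv b (k - 1 - j) t *\<^sub>R c j) has_vector_derivative frac_kernel_deriv b (k - j) t *\<^sub>R c j) (at t)"
    if "j < k" for j
  proof -
    have "Suc (k - 1 - j) = k - j" using that by simp
    then show ?thesis
      using has_vector_derivative_scaleR[OF frac_kernel_deriv_has_derivative[OF t, of b "k - 1 - j"]
          has_vector_derivative_const[of "c j"]] by simp
  qed
  then have "(RL_boundary b c k has_vector_derivative (\<Sum>j<k. frac_kernel_deriv b (k - j) t *\<^sub>R c j)) (at t)"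
    unfolding RL_boundary_def by (intro has_vector_derivative_sum) auto
  then show ?thesis by (simp add: RL_boundary_def frac_kernel_deriv_0)
qed

lemma powr_exp_bound:
  assumes "0 \<le> (a::real)"
  obtains C where "0 \<le> C" "\<And>t. 0 < t \<Longrightarrow> t powr a * exp (t / 4) \<le> C * exp (t / 2)"
proof -
  obtain C where C: "0 \<le> C" "\<And>t. 0 \<le> t \<Longrightarrow> t powr a \<le> C * exp (1 / 4 * t)"
    using powr_le_exp[OF assms, of "1 / 4"] by auto
  show thesis
  proof (rule that[OF C(1)])
    fix t :: real assume "0 < t"
    then have "t powr a * exp (t / 4) \<le> C * exp (1 / 4 * t) * exp (t / 4)"
      by (intro mult_right_mono C) auto
    also have "\<dots> = C * exp (t / 2)" by (simp add: mult.assoc exp_add[symmetric])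
    finally show "t powr a * exp (t / 4) \<le> C * exp (t / 2)" .
  qed
qed

text \<open>The term with index \<open>j\<close> is a multiple of \<open>t powr (b + j - k)\<close>, so multiplication by \<open>t ^ k\<close> leaves a
positive power.\<close>

lemma RL_boundary_bound:
  assumes b: "0 < b"
  shows "\<exists>C. \<forall>t>0. t ^ k * norm (RL_boundary b c k t) \<le> C * exp (t / 2)"
proof -
  have "\<exists>C. \<forall>t>0. t ^ k * norm (frac_kernel_deriv b (k - 1 - j) t *\<^sub>R c j) \<le> C * exp (t / 2)" if j: "j < k" for j
  proof -
    obtain C where C: "0 \<le> C" "\<And>t. 0 < t \<Longrightarrow> t powr (b + real j) * exp (t / 4) \<le> C * exp (t / 2)"
      using powr_exp_bound[of "b + real j"] b by auto
    define D where "D = \<bar>(\<Prod>l<k - 1 - j. b - 1 - real l) / Gamma b\<bar> * norm (c j)"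
    have "t ^ k * norm (frac_kernel_deriv b (k - 1 - j) t *\<^sub>R c j) \<le> D * C * exp (t / 2)" if t: "0 < t" for t
    proof -
      have "t ^ k * t powr (b - 1 - real (k - 1 - j)) = t powr (b + real j)"
        using t j by (simp add: powr_realpow[symmetric] powr_add[symmetric])
      then have "t ^ k * norm (frac_kernel_deriv b (k - 1 - j) t *\<^sub>R c j) = D * t powr (b + real j)"
        by (simp add: frac_kernel_deriv_def D_def abs_mult)
      also have "\<dots> \<le> D * (t powr (b + real j) * exp (t / 4))"
        using t by (intro mult_left_mono) (auto simp: D_def mult_le_cancel_left1)
      also have "\<dots> \<le> D * (C * exp (t / 2))"
        using t by (intro mult_left_mono C) (auto simp: D_def)
      finally show ?thesis by simp
    qed
    then show ?thesis by blast
  qed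
  then obtain C where C: "\<And>j t. j < k \<Longrightarrow> 0 < t \<Longrightarrow>
      t ^ k * norm (frac_kernel_deriv b (k - 1 - j) t *\<^sub>R c j) \<le> C j * exp (t / 2)"
    by metis
  have "t ^ k * norm (RL_boundary b c k t) \<le> (\<Sum>j<k. C j) * exp (t / 2)" if t: "0 < t" for t
  proof -
    have "t ^ k * norm (RL_boundary b c k t) \<le> t ^ k * (\<Sum>j<k. norm (frac_kernel_deriv b (k - 1 - j) t *\<^sub>R c j))"
      unfolding RL_boundary_def using t by (intro mult_left_mono norm_sum) auto
    also have "\<dots> \<le> (\<Sum>j<k. C j * exp (t / 2))"
      unfolding sum_distrib_left using t by (intro sum_mono C) auto
    finally show ?thesis by (simp add: sum_distrib_right)
  qed
  then show ?thesis by blast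
qed

lemma frac_conv_bound:
  fixes v :: "real \<Rightarrow> 'a::banach"
  assumes b: "0 < b" and v: "continuous_on {0..} v"
    and le: "\<And>s. 0 \<le> s \<Longrightarrow> norm (v s) \<le> C * exp (s / 4)"
  shows "\<exists>D. \<forall>t>0. t ^ k * norm (frac_conv b (\<lambda>_. 1) v t) \<le> D * exp (t / 2)"
proof -
  obtain K where K: "0 \<le> K" "\<And>t. 0 < t \<Longrightarrow> t powr (b + real k) * exp (t / 4) \<le> K * exp (t / 2)"
    using powr_exp_bound[of "b + real k"] b by auto
  have C: "0 \<le> C" using order_trans[OF norm_ge_zero le[of 0]] by simp
  have G: "0 < Gamma (b + 1)" using b by (intro Gamma_real_pos) simp
  have "t ^ k * norm (frac_conv b (\<lambda>_. 1) v t) \<le> C / Gamma (b + 1) * K * exp (t / 2)" if t: "0 < t" for t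
  proof -
    have "norm (frac_conv b (\<lambda>_. 1) v t) \<le> t powr b / Gamma (b + 1) * (C * exp (t / 4))"
    proof (rule frac_conv_norm_le_const)
      fix r s :: real assume "0 \<le> r" "0 \<le> s" "r + s = t"
      then have "norm (v s) \<le> C * exp (s / 4)" "exp (s / 4) \<le> exp (t / 4)" by (auto intro: le)
      then show "norm (1 *\<^sub>R v s) \<le> C * exp (t / 4)"
        using mult_left_mono[OF _ C] by (auto intro: order_trans)
    qed (use b t v in auto)
    then have "t ^ k * norm (frac_conv b (\<lambda>_. 1) v t) \<le> t ^ k * (t powr b / Gamma (b + 1) * (C * exp (t / 4)))"
      using t by (intro mult_left_mono) auto
    also have "\<dots> = C / Gamma (b + 1) * (t powr (b + real k) * exp (t / 4))"
      using t by (simp add: powr_add powr_realpow)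
    also have "\<dots> \<le> C / Gamma (b + 1) * (K * exp (t / 2))"
      using t C G by (intro mult_left_mono K) auto
    finally show ?thesis by simp
  qed
  then show ?thesis by blast
qed

lemma norm_bound_by_derivative:
  fixes f :: "real \<Rightarrow> 'a::banach"
  assumes f: "\<And>t. 0 \<le> t \<Longrightarrow> (f has_vector_derivative f' t) (at t within {0..})"
    and f': "continuous_on {0..} f'" and T: "0 \<le> T"
  shows "norm (f T) \<le> norm (f 0) + integral {0..T} (\<lambda>s. norm (f' s))"
proof -
  have "(f' has_integral f T - f 0) {0..T}"
    using T by (intro fundamental_theorem_of_calculus)
      (auto intro: has_vector_derivative_within_subset[OF f])
  then have "f T - f 0 = integral {0..T} f'" by (simp add: integral_unique)
  also have "norm \<dots> \<le> integral {0..T} (\<lambda>s. norm (f' s))"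
    by (intro integral_norm_bound_integral integrable_continuous_real continuous_intros
        continuous_on_subset[OF f']) auto
  finally show ?thesis using norm_triangle_ineq2[of "f T" "f 0"] by linarith
qed

text \<open>Downwards from \<open>U (m - 1)\<close>, which is bounded because its derivative is absolutely integrable, each
integration reproduces a bound by a multiple of \<open>exp (t / 4)\<close>.\<close>

lemma lower_derivatives_exp_bound:
  fixes U :: "nat \<Rightarrow> real \<Rightarrow> 'a::banach"
  assumes U: "\<And>k t. k < m \<Longrightarrow> 0 \<le> t \<Longrightarrow> (U k has_vector_derivative U (Suc k) t) (at t within {0..})"
    and c: "\<And>k. k \<le> m \<Longrightarrow> continuous_on {0..} (U k)"
    and B: "\<And>T. 0 \<le> T \<Longrightarrow> integral {0..T} (\<lambda>s. norm (U m s)) \<le> B"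
    and "k < m"
  shows "\<exists>C. \<forall>t\<ge>0. norm (U k t) \<le> C * exp (t / 4)"
proof -
  have "\<exists>C. \<forall>t\<ge>0. norm (U (m - Suc i) t) \<le> C * exp (t / 4)" if "i < m" for i
    using that
  proof (induction i)
    case 0
    have B0: "0 \<le> B" using B[of 0] by simp
    have S: "Suc (m - Suc 0) = m" using 0 by simp
    have "norm (U (m - Suc 0) t) \<le> (norm (U (m - Suc 0) 0) + B) * exp (t / 4)" if t: "0 \<le> t" for t
    proof -
      have "norm (U (m - Suc 0) t) \<le> norm (U (m - Suc 0) 0) + integral {0..t} (\<lambda>s. norm (U m s))"
        using U[of "m - Suc 0"] 0 S c[of m] t by (intro norm_bound_by_derivative) auto
      also have "\<dots> \<le> (norm (U (m - Suc 0) 0) + B) * 1" using B[OF t] by simp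
      also have "\<dots> \<le> (norm (U (m - Suc 0) 0) + B) * exp (t / 4)"
        using t B0 by (intro mult_left_mono) auto
      finally show ?thesis .
    qed
    then show ?case by blast
  next
    case (Suc i)
    then obtain C where C: "\<And>t. 0 \<le> t \<Longrightarrow> norm (U (m - Suc i) t) \<le> C * exp (t / 4)" by auto
    have S: "Suc (m - Suc (Suc i)) = m - Suc i" using Suc.prems by simp
    let ?V = "U (m - Suc (Suc i))"
    have C0: "0 \<le> C" using order_trans[OF norm_ge_zero C[of 0]] by simp
    have "norm (?V t) \<le> (norm (?V 0) + 4 * C) * exp (t / 4)" if t: "0 \<le> t" for t
    proof -
      have "norm (?V t) \<le> norm (?V 0) + integral {0..t} (\<lambda>s. norm (U (m - Suc i) s))"
        using U[of "m - Suc (Suc i)"] Suc.prems S c[of "m - Suc i"] t by (intro norm_bound_by_derivative) auto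
      also have "integral {0..t} (\<lambda>s. norm (U (m - Suc i) s)) \<le> integral {0..t} (\<lambda>s. C * exp (s / 4))"
        using Suc.prems
        by (intro integral_le integrable_continuous_real continuous_intros continuous_on_subset[OF c] C) auto
      also have "\<dots> = 4 * C * exp (t / 4) - 4 * C * exp (0 / 4)"
        using t by (intro integral_unique fundamental_theorem_of_calculus)
          (auto intro!: derivative_eq_intros simp: has_real_derivative_iff_has_vector_derivative[symmetric])
      also have "\<dots> \<le> 4 * C * exp (t / 4)" using C0 by simp
      also have "norm (?V 0) \<le> norm (?V 0) * exp (t / 4)" using t by (simp add: mult_le_cancel_left1)
      finally show ?thesis by (simp add: distrib_right)
    qed
    then show ?case by blast
  qed
  from this[of "m - Suc k"] \<open>k < m\<close> show ?thesis by simp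
qed

lemma exp_weighted_integrable_bound:
  fixes w :: "real \<Rightarrow> 'a::banach"
  assumes w: "continuous_on {0..} w" and \<omega>: "0 \<le> \<omega>"
    and int: "bochner_integrable {0..} (\<lambda>t. exp (\<omega> * t) *\<^sub>R w t)"
  obtains B where "\<And>T. integral {0..T} (\<lambda>s. norm (w s)) \<le> B"
proof -
  let ?M = "lebesgue_on {0::real..}" and ?f = "\<lambda>t. exp (\<omega> * t) *\<^sub>R w t"
  have "(\<lambda>t. norm (?f t)) \<in> borel_measurable ?M"
    by (intro continuous_imp_measurable_on_sets_lebesgue continuous_intros w) auto
  then have fin: "(\<integral>\<^sup>+t. ennreal (norm (?f t)) \<partial>?M) < \<infinity>"
    by (rule bochner_integrable_nn_integral_finite[OF int])
  define B where "B = enn2real (\<integral>\<^sup>+t. ennreal (norm (?f t)) \<partial>?M)"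
  have B: "ennreal B = (\<integral>\<^sup>+t. ennreal (norm (?f t)) \<partial>?M)"
    unfolding B_def using fin by simp
  have "integral {0..T} (\<lambda>s. norm (w s)) \<le> B" for T
  proof -
    have "((\<lambda>s. norm (w s)) has_integral integral {0..T} (\<lambda>s. norm (w s))) {0..T}"
      by (intro integrable_integral integrable_continuous_real continuous_intros continuous_on_subset[OF w]) auto
    then have "ennreal (integral {0..T} (\<lambda>s. norm (w s))) = (\<integral>\<^sup>+s. ennreal (norm (w s)) * indicator {0..T} s \<partial>lborel)"
      by (intro nn_integral_has_integral_lebesgue'[symmetric]) auto
    also have "\<dots> = (\<integral>\<^sup>+s. ennreal (norm (w s)) * indicator {0..T} s \<partial>lebesgue)"
      by (simp add: nn_integral_completion)
    also have "\<dots> \<le> (\<integral>\<^sup>+s. ennreal (norm (?f s)) * indicator {0..} s \<partial>lebesgue)"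
    proof (rule nn_integral_mono)
      fix s :: real
      show "ennreal (norm (w s)) * indicator {0..T} s \<le> ennreal (norm (?f s)) * indicator {0..} s"
        using \<omega> by (auto simp: indicator_def mult_le_cancel_right1 intro!: ennreal_leI)
    qed
    also have "\<dots> = ennreal B"
      unfolding B by (intro nn_integral_restrict_space[symmetric]) auto
    finally show ?thesis by (simp add: B_def)
  qed
  then show thesis by (rule that)
qed

text \<open>The function \<open>w\<close> is absolutely integrable but possibly unbounded, so that no pointwise bound on \<open>g\<^sub>b * w\<close> is available. The
integral identity applied to \<open>norm w\<close> reduces the claim to the antiderivatives of \<open>p\<^sub>j * norm w\<close>,
which are at most \<open>B\<close>.\<close>

lemma frac_conv_poisson_L1_bound:
  fixes w :: "real \<Rightarrow> 'a::banach"
  assumes b: "0 < b" and w: "continuous_on {0..} w"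
    and B: "\<And>T. 0 \<le> T \<Longrightarrow> integral {0..T} (\<lambda>s. norm (w s)) \<le> B"
  shows "integral (window i) (\<lambda>t. norm (poisson_kernel N t *\<^sub>R frac_conv b (\<lambda>_. 1) w t))
    \<le> (\<Sum>j\<le>N. B * cesaro b (N - j))"
proof -
  let ?p = "poisson_kernel" and ?n = "\<lambda>s. norm (w s)"
  define T where "T = real i + 1"
  have T: "0 \<le> T" "window i \<subseteq> {0..T}" using window_subset[of i] by (auto simp: T_def)
  have nc: "continuous_on {0..} ?n" by (intro continuous_intros w)
  define A where "A j s = integral {0..s} (\<lambda>r. ?p j r *\<^sub>R ?n r)" for j s
  have A: "A j s \<le> B" if s: "0 \<le> s" for j s
  proof -
    have "A j s \<le> integral {0..s} ?n"
      unfolding A_def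
      by (intro integral_le integrable_continuous_real continuous_intros continuous_on_subset[OF w])
        (auto intro!: mult_left_le_one_le poisson_kernel_nonneg poisson_kernel_le_1)
    then show ?thesis using B[OF s] by simp
  qed
  have A0: "0 \<le> A j s" for j s
    unfolding A_def
    by (intro integral_nonneg integrable_continuous_real continuous_intros continuous_on_subset[OF w])
        (auto intro!: mult_nonneg_nonneg poisson_kernel_nonneg)
  have dA: "(A j has_vector_derivative ?p j s *\<^sub>R ?n s) (at s within {0..})" if "0 \<le> s" for j s
    unfolding A_def by (intro integral_has_vector_derivative_nonneg continuous_intros w that)
  have Ac: "continuous_on {0..} (A j)" for j
    by (intro continuous_on_vector_derivative[where f' = "\<lambda>s. ?p j s *\<^sub>R ?n s"] dA) auto
  have B0: "0 \<le> B" using B[of 0] by simp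
  have fc: "continuous_on {0..} (frac_conv b (\<lambda>_. 1) w)" "continuous_on {0..} (frac_conv b (\<lambda>_. 1) ?n)"
    by (intro continuous_on_frac_conv b continuous_intros w)+
  have le: "norm (?p N t *\<^sub>R frac_conv b (\<lambda>_. 1) w t) \<le> ?p N t *\<^sub>R frac_conv b (\<lambda>_. 1) ?n t" if "0 \<le> t" for t
    using that frac_conv_norm_le[OF b that _ w _ nc, of "\<lambda>_. 1" "\<lambda>_. 1"]
    by (auto intro!: mult_left_mono simp: poisson_kernel_nonneg)
  have "integral (window i) (\<lambda>t. norm (?p N t *\<^sub>R frac_conv b (\<lambda>_. 1) w t))
      \<le> integral {0..T} (\<lambda>t. norm (?p N t *\<^sub>R frac_conv b (\<lambda>_. 1) w t))"
    by (intro integral_subset_le T integrable_continuous_real continuous_intros continuous_on_subset[OF fc(1)])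
      (use T in auto)
  also have "\<dots> \<le> integral {0..T} (\<lambda>t. ?p N t *\<^sub>R frac_conv b (\<lambda>_. 1) ?n t)"
    by (intro integral_le integrable_continuous_real continuous_intros continuous_on_subset[OF fc(1)]
        continuous_on_subset[OF fc(2)] le) auto
  also have "\<dots> = (\<Sum>j\<le>N. frac_conv b (?p (N - j)) (A j) T)"
    unfolding A_def by (intro integral_unique poisson_kernel_frac_conv_has_integral b nc T)
  also have "\<dots> \<le> (\<Sum>j\<le>N. B * cesaro b (N - j))"
  proof (rule sum_mono)
    fix j
    have "frac_conv b (?p (N - j)) (A j) T \<le> norm (frac_conv b (?p (N - j)) (A j) T)" by simp
    also have "\<dots> \<le> frac_conv b (?p (N - j)) (\<lambda>_. B) T"
      using A A0 by (intro frac_conv_norm_le b T Ac continuous_intros)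
        (auto simp: abs_mult poisson_kernel_nonneg intro!: mult_left_mono)
    also have "\<dots> = B * frac_conv b (?p (N - j)) (\<lambda>_. 1) T"
      by (subst frac_conv_const[OF b T(1)]) (auto intro!: continuous_intros)
    also have "\<dots> \<le> B * cesaro b (N - j)"
      by (intro mult_left_mono frac_conv_poisson_kernel_le b T B0)
    finally show "frac_conv b (?p (N - j)) (A j) T \<le> B * cesaro b (N - j)" .
  qed
  finally show ?thesis .
qed

text \<open>The singularity of the kernel sits at \<open>s = t\<close>, so \<open>[0, t)\<close> is exhausted from the left.\<close>

lemma RL_integral_has_bochner:
  fixes u :: "real \<Rightarrow> 'a::banach"
  assumes b: "0 < b" and u: "continuous_on {0..} u" and t: "0 < t"
  shows "has_bochner {0..t} (\<lambda>s. frac_kernel b (t - s) *\<^sub>R u s) (frac_conv b (\<lambda>_. 1) u t)"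
proof -
  let ?f = "\<lambda>s. frac_kernel b (t - s) *\<^sub>R u s" and ?c = "t powr b / Gamma (b + 1)"
  define x where "x i = t - t / (real i + 2)" for i
  have x: "0 \<le> x i" "x i < t" for i
    using t by (auto simp: x_def field_simps)
  have c: "0 \<le> ?c" using b Gamma_real_pos[of "b + 1"] by (simp add: less_imp_le)
  have z: "1 - x i / t = 1 / (real i + 2)" for i
    using t by (simp add: x_def diff_divide_distrib)
  have fcont: "continuous_on {0..x i} ?f" for i
    unfolding frac_kernel_def using x[of i] Gamma_real_plus1[OF b]
    by (intro continuous_intros continuous_on_subset[OF u]) auto
  show ?thesis
  proof (rule has_bochner_exhaustion[where a = "\<lambda>_. 0" and b = x])
    show "{0..x i} \<subseteq> {0..t}" for i using x[of i] by auto
    show "decseq (\<lambda>_. 0::real)" by (simp add: decseq_def)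
    show "incseq x"
      using t by (auto simp: incseq_def x_def intro!: divide_left_mono mult_pos_pos)
    show "continuous_on {0..x i} ?f" for i by (rule fcont)
    have "AE s in lebesgue. s \<noteq> t"
      by (rule AE_I'[of "{t}"]) auto
    then have "AE s in lebesgue_on {0..t}. s \<noteq> t"
      by (auto simp: AE_restrict_space_iff elim: eventually_mono)
    moreover have "AE s in lebesgue_on {0..t}. s \<in> {0..t}"
      by (rule AE_I2) simp
    ultimately show "AE s in lebesgue_on {0..t}. \<exists>i. s \<in> {0..x i}"
    proof eventually_elim
      case (elim s)
      then have s: "0 \<le> s" "s < t" by auto
      obtain i where "t / (t - s) < real i" using reals_Archimedean2 by blast
      then have "t \<le> (t - s) * (real i + 2)" using s by (simp add: divide_less_eq algebra_simps)
      then have "t / (real i + 2) \<le> t - s" by (simp add: divide_le_eq)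
      then show ?case using s by (intro exI[of _ i]) (auto simp: x_def)
    qed
    show "integral {0..x i} (\<lambda>s. norm (?f s)) \<le> frac_conv b (\<lambda>_. 1) (\<lambda>s. norm (u s)) t" for i
    proof -
      let ?I = "integral {0..(1 - x i / t) powr b} (\<lambda>y. norm (u (t * (1 - y powr (1 / b)))))"
      have "norm (?f s) = frac_kernel b (t - s) *\<^sub>R norm (u s)" if "s \<in> {0..x i}" for s
        using that Gamma_real_pos[OF b] x[of i] by (simp add: frac_kernel_def)
      then have "integral {0..x i} (\<lambda>s. norm (?f s)) = integral {0..x i} (\<lambda>s. frac_kernel b (t - s) *\<^sub>R norm (u s))"
        by (intro integral_cong) auto
      also have "\<dots> = frac_conv b (\<lambda>_. 1) (\<lambda>s. norm (u s)) t - ?c *\<^sub>R ?I"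
        by (intro integral_unique frac_kernel_convolution_has_integral b x continuous_intros u)
      also have "\<dots> \<le> frac_conv b (\<lambda>_. 1) (\<lambda>s. norm (u s)) t"
      proof -
        have "0 \<le> ?I"
        proof (cases "(\<lambda>y. norm (u (t * (1 - y powr (1 / b))))) integrable_on {0..(1 - x i / t) powr b}")
          case True
          then show ?thesis by (rule integral_nonneg) simp
        qed (simp add: not_integrable_integral)
        then have "0 \<le> ?c *\<^sub>R ?I"
          unfolding real_scaleR_def by (rule mult_nonneg_nonneg[OF c])
        then show ?thesis by linarith
      qed
      finally show ?thesis .
    qed
    show "(\<lambda>i. integral {0..x i} ?f) \<longlonglongrightarrow> frac_conv b (\<lambda>_. 1) u t"
    proof -
      define H where "H z = integral {0..z} (\<lambda>y. u (t * (1 - y powr (1 / b))))" for z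
      have "continuous_on {0..1} (\<lambda>y. u (t * (1 - y powr (1 / b))))"
        using continuous_on_frac_conv_integrand'[of b "\<lambda>_. 1" u t] b u t by simp
      then have H: "continuous_on {0..1} H"
        unfolding H_def by (intro indefinite_integral_continuous_1 integrable_continuous_real)
      have "(\<lambda>i. 1 / (real i + 2)) \<longlonglongrightarrow> 0"
        using LIMSEQ_ignore_initial_segment[OF inverse_real_plus_1_tendsto, of 1] by (simp add: add_ac)
      then have "(\<lambda>i. (1 / (real i + 2)) powr b) \<longlonglongrightarrow> 0 powr b"
        using b by (intro tendsto_powr' tendsto_const) auto
      then have "(\<lambda>i. (1 / (real i + 2)) powr b) \<longlonglongrightarrow> 0" by simp
      then have Hlim: "(\<lambda>i. H ((1 / (real i + 2)) powr b)) \<longlonglongrightarrow> H 0"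
        using b by (intro continuous_on_tendsto_compose[OF H] always_eventually allI)
          (auto intro!: powr_unit_interval)
      moreover have "integral {0..x i} ?f = frac_conv b (\<lambda>_. 1) u t - ?c *\<^sub>R H ((1 / (real i + 2)) powr b)" for i
        using frac_kernel_convolution_has_integral[OF b u x, of i] unfolding z H_def
        by (rule integral_unique)
      ultimately show ?thesis
        using tendsto_diff[OF tendsto_const[of "frac_conv b (\<lambda>_. 1) u t"] tendsto_scaleR[OF tendsto_const[of ?c] Hlim]]
        by (simp add: H_def)
    qed
  qed auto
qed

section \<open>The Poisson transform of fractional integrals and derivatives\<close>

lemma poisson_of_exp_bounded:
  fixes u :: "real \<Rightarrow> 'a::banach"
  assumes u: "continuous_on {0..} u" and le: "\<And>s. 0 \<le> s \<Longrightarrow> norm (u s) \<le> C * exp (s / 4)"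
  shows "has_bochner {0..} (\<lambda>t. poisson_kernel n t *\<^sub>R u t) (poisson u n)"
    and "(\<lambda>i. integral (window i) (\<lambda>t. poisson_kernel n t *\<^sub>R u t)) \<longlonglongrightarrow> poisson u n"
    and "\<exists>K. \<forall>T\<ge>0. norm (integral {0..T} (\<lambda>t. poisson_kernel n t *\<^sub>R u t) - poisson u n) \<le> K * exp (- (T / 2))"
proof -
  let ?f = "\<lambda>t. poisson_kernel n t *\<^sub>R u t"
  have f: "continuous_on {0..} ?f" by (intro continuous_intros u)
  have f_le: "norm (?f s) \<le> (4 ^ n * C) * exp (- (1 / 2 * s))" if s: "0 \<le> s" for s
  proof -
    have "norm (?f s) \<le> (4 ^ n * exp (- (3 / 4 * s))) * (C * exp (s / 4))"
      using s poisson_kernel_le_exp[of "1/4" s n]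
      by (auto simp: poisson_kernel_nonneg intro!: mult_mono le)
    also have "\<dots> = 4 ^ n * C * (exp (- (3 / 4 * s)) * exp (s / 4))" by simp
    also have "exp (- (3 / 4 * s)) * exp (s / 4) = exp (- (1 / 2 * s))"
      by (simp add: exp_add[symmetric])
    finally show ?thesis .
  qed
  obtain L where L: "\<And>T. 0 \<le> T \<Longrightarrow> norm (integral {0..T} ?f - L) \<le> (4 ^ n * C) / (1 / 2) * exp (- (1 / 2 * T))"
    using exp_decay_integral_converges[OF _ f f_le] by auto
  have "((\<lambda>T. integral {0..T} ?f - L) \<longlongrightarrow> 0) at_top"
  proof (rule Lim_null_comparison)
    show "\<forall>\<^sub>F T in at_top. norm (integral {0..T} ?f - L) \<le> (4 ^ n * C) / (1 / 2) * exp (- (1 / 2 * T))"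
      using eventually_ge_at_top[of 0] by eventually_elim (rule L)
    show "((\<lambda>T. (4 ^ n * C) / (1 / 2) * exp (- (1 / 2 * T))) \<longlongrightarrow> 0) at_top"
      by (intro tendsto_mult_right_zero exp_decay_tendsto) simp
  qed
  then have "((\<lambda>T. integral {0..T} ?f) \<longlongrightarrow> L) at_top" by (rule LIM_zero_cancel)
  then have lim: "(\<lambda>i. integral (window i) ?f) \<longlonglongrightarrow> L" by (rule integral_window_tendsto[OF f])
  have "integral (window i) (\<lambda>t. norm (?f t)) \<le> (4 ^ n * C) / (1 / 2)" for i
    by (rule integral_window_norm_le_exp[OF _ continuous_on_subset[OF f] f_le]) auto
  then have hb: "has_bochner {0..} ?f L"
    using lim by (intro has_bochner_window continuous_on_subset[OF f]) auto
  then have "poisson u n = L" unfolding poisson_def by (intro bochner_eq) auto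
  with hb lim L show "has_bochner {0..} ?f (poisson u n)"
    "(\<lambda>i. integral (window i) ?f) \<longlonglongrightarrow> poisson u n"
    "\<exists>K. \<forall>T\<ge>0. norm (integral {0..T} ?f - poisson u n) \<le> K * exp (- (T / 2))"
    by auto
qed

text \<open>The convolution identity: the limit of \<open>poisson_kernel_frac_conv_has_integral\<close> as the upper limit of
integration tends to infinity.\<close>

lemma poisson_frac_conv_limit:
  fixes u :: "real \<Rightarrow> 'a::banach"
  assumes b: "0 < b" and u: "continuous_on {0..} u" and le: "\<And>s. 0 \<le> s \<Longrightarrow> norm (u s) \<le> C * exp (s / 4)"
  shows "(\<lambda>i. integral (window i) (\<lambda>t. poisson_kernel n t *\<^sub>R frac_conv b (\<lambda>_. 1) u t))
    \<longlonglongrightarrow> (\<Sum>j\<le>n. cesaro b (n - j) *\<^sub>R poisson u j)"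
proof (rule integral_window_tendsto)
  let ?A = "\<lambda>j s. integral {0..s} (\<lambda>r. poisson_kernel j r *\<^sub>R u r)"
  show "continuous_on {0..} (\<lambda>t. poisson_kernel n t *\<^sub>R frac_conv b (\<lambda>_. 1) u t)"
    by (intro continuous_intros continuous_on_frac_conv b u)
  have "(frac_conv b (poisson_kernel (n - j)) (?A j) \<longlongrightarrow> cesaro b (n - j) *\<^sub>R poisson u j) at_top" for j
  proof -
    obtain K where "\<And>T. 0 \<le> T \<Longrightarrow> norm (?A j T - poisson u j) \<le> K * exp (- (T / 2))"
      using poisson_of_exp_bounded(3)[OF u le] by blast
    moreover have "continuous_on {0..} (?A j)"
      by (rule continuous_on_vector_derivative[where f' = "\<lambda>r. poisson_kernel j r *\<^sub>R u r"])
        (auto intro!: integral_has_vector_derivative_nonneg continuous_intros u)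
    ultimately show ?thesis by (intro frac_conv_poisson_kernel_limit b) auto
  qed
  then have "((\<lambda>T. \<Sum>j\<le>n. frac_conv b (poisson_kernel (n - j)) (?A j) T)
      \<longlongrightarrow> (\<Sum>j\<le>n. cesaro b (n - j) *\<^sub>R poisson u j)) at_top"
    by (intro tendsto_sum)
  moreover have "\<forall>\<^sub>F T in at_top. (\<Sum>j\<le>n. frac_conv b (poisson_kernel (n - j)) (?A j) T)
      = integral {0..T} (\<lambda>t. poisson_kernel n t *\<^sub>R frac_conv b (\<lambda>_. 1) u t)"
    using eventually_ge_at_top[of 0]
    by eventually_elim (intro integral_unique[symmetric] poisson_kernel_frac_conv_has_integral b u)
  ultimately show "((\<lambda>T. integral {0..T} (\<lambda>t. poisson_kernel n t *\<^sub>R frac_conv b (\<lambda>_. 1) u t))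
      \<longlongrightarrow> (\<Sum>j\<le>n. cesaro b (n - j) *\<^sub>R poisson u j)) at_top"
    by (rule Lim_transform_eventually)
qed

lemma at_within_nonneg: "0 < t \<Longrightarrow> at t within {0..} = at (t::real)"
  by (intro at_within_interior) auto

lemma iter_deriv_Suc: "iter_deriv (Suc k) f t = vector_derivative (iter_deriv k f) (at t within {0..})"
  by (simp add: iter_deriv_def)

text \<open>The derivatives at a point \<open>t > 0\<close> see only a neighbourhood of \<open>t\<close> inside \<open>(0, \<infinity>)\<close>, so it does not
matter whether they exist at \<open>0\<close>.\<close>

lemma iter_deriv_on_positive:
  assumes f: "\<And>t. 0 < t \<Longrightarrow> f t = h 0 t"
    and h: "\<And>k t. k < m \<Longrightarrow> 0 < t \<Longrightarrow> (h k has_vector_derivative h (Suc k) t) (at t)"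
  shows "k \<le> m \<Longrightarrow> 0 < t \<Longrightarrow> iter_deriv k f t = h k t"
    and "times_differentiable_on m f {0<..}"
proof -
  have der: "(iter_deriv k f has_vector_derivative h (Suc k) t) (at t within {0..})"
    if "k < m" "0 < t" "\<And>t. 0 < t \<Longrightarrow> iter_deriv k f t = h k t" for k t
    unfolding at_within_nonneg[OF that(2)]
    by (rule has_vector_derivative_transform_within_open[OF h[OF that(1,2)], of "{0<..}"])
      (use that in auto)
  have eq: "\<forall>t>0. iter_deriv k f t = h k t" if "k \<le> m" for k
    using that
  proof (induction k)
    case (Suc k)
    then have IH: "\<And>t. 0 < t \<Longrightarrow> iter_deriv k f t = h k t" by auto
    show ?case
    proof (intro allI impI)
      fix t :: real assume t: "0 < t"
      have "(iter_deriv k f has_vector_derivative h (Suc k) t) (at t)"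
        using der[OF _ t IH] Suc.prems at_within_nonneg[OF t] by auto
      then show "iter_deriv (Suc k) f t = h (Suc k) t"
        unfolding iter_deriv_Suc at_within_nonneg[OF t] by (rule vector_derivative_at)
    qed
  qed (simp add: iter_deriv_def f)
  then show "k \<le> m \<Longrightarrow> 0 < t \<Longrightarrow> iter_deriv k f t = h k t" by blast
  show "times_differentiable_on m f {0<..}"
    unfolding times_differentiable_on_def
    using der eq by (auto intro!: differentiableI_vector)
qed

text \<open>The common part of the cases \<open>\<alpha> = m\<close> and \<open>\<alpha> < m\<close>: \<open>h\<close> lists the successive derivatives on \<open>(0, \<infinity>)\<close> of
the function that the definition of the fractional derivative differentiates \<open>m\<close> times.\<close>

lemma poisson_RL_deriv:
  fixes h :: "nat \<Rightarrow> real \<Rightarrow> 'a::banach"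
  assumes m: "nat \<lceil>\<alpha>\<rceil> = m"
    and h0: "\<And>t. 0 < t \<Longrightarrow> RL_integral_part \<alpha> u t = h 0 t"
    and h: "\<And>k t. k < m \<Longrightarrow> 0 < t \<Longrightarrow> (h k has_vector_derivative h (Suc k) t) (at t)"
    and cont: "continuous_on {0<..} (h m)"
    and bound: "\<And>k. k < m \<Longrightarrow> \<exists>C. \<forall>t>0. t ^ k * norm (h k t) \<le> C * exp (t / 2)"
    and L1: "\<And>n. \<exists>B. \<forall>i. integral (window i) (\<lambda>t. norm (poisson_kernel (n + m) t *\<^sub>R h m t)) \<le> B"
    and lim: "\<And>n. (\<lambda>i. integral (window i) (\<lambda>t. poisson_kernel n t *\<^sub>R h 0 t)) \<longlonglongrightarrow> RL_sum_part \<alpha> v n"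
  shows "times_differentiable_on m (RL_integral_part \<alpha> u) {0<..}"
    and "has_bochner {0..} (\<lambda>t. poisson_kernel (n + m) t *\<^sub>R RL_deriv \<alpha> u t) (RL_diff \<alpha> v n)"
proof -
  show "times_differentiable_on m (RL_integral_part \<alpha> u) {0<..}"
    by (rule iter_deriv_on_positive(2)[of _ h, OF h0 h])
  have eq: "RL_deriv \<alpha> u t = h m t" if "0 < t" for t
    unfolding RL_deriv_def m using that by (intro iter_deriv_on_positive(1)[of _ h m, OF h0 h]) auto
  let ?f = "\<lambda>t. poisson_kernel (n + m) t *\<^sub>R RL_deriv \<alpha> u t" and ?g = "\<lambda>t. poisson_kernel (n + m) t *\<^sub>R h m t"
  have fg: "?f t = ?g t" if "t \<in> window i" for t i
    using that window_subset[of i] eq by auto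
  obtain B where B: "\<And>i. integral (window i) (\<lambda>t. norm (?g t)) \<le> B" using L1 by blast
  have "(\<lambda>i. integral (window i) ?g) \<longlonglongrightarrow> RL_diff \<alpha> v n"
    unfolding RL_diff_def m by (intro poisson_iterated_derivative[of m h] h cont bound lim order_refl)
  moreover have "integral (window i) ?f = integral (window i) ?g" for i
    by (intro integral_cong fg)
  moreover have "integral (window i) (\<lambda>t. norm (?f t)) = integral (window i) (\<lambda>t. norm (?g t))" for i
    using fg by (intro integral_cong) metis
  moreover have "continuous_on {0<..} ?f"
  proof -
    have "continuous_on {0<..} ?g" by (intro continuous_intros cont)
    then show ?thesis by (rule continuous_on_eq) (use eq in auto)
  qed
  ultimately show "has_bochner {0..} ?f (RL_diff \<alpha> v n)"
    using B by (intro has_bochner_window[where B = B]) auto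
qed

text \<open>Iterating \<open>(g\<^sub>b * v)' = g\<^sub>b v(0) + g\<^sub>b * v'\<close> gives the derivatives \<open>h k\<close> of the fractional integral in
closed form. The top one, \<open>h m\<close>, contains \<open>g\<^sub>b * U m\<close> with \<open>U m\<close> possibly unbounded, and is therefore
estimated in mean and not pointwise.\<close>

lemma RL_chain:
  fixes U :: "nat \<Rightarrow> real \<Rightarrow> 'a::banach"
  assumes b: "0 < b"
    and U: "\<And>k t. k < m \<Longrightarrow> 0 \<le> t \<Longrightarrow> (U k has_vector_derivative U (Suc k) t) (at t within {0..})"
    and c: "\<And>k. k \<le> m \<Longrightarrow> continuous_on {0..} (U k)"
    and B: "\<And>T. 0 \<le> T \<Longrightarrow> integral {0..T} (\<lambda>s. norm (U m s)) \<le> B"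
  defines "h \<equiv> \<lambda>k t. RL_boundary b (\<lambda>j. U j 0) k t + frac_conv b (\<lambda>_. 1) (U k) t"
  shows "\<And>k t. k < m \<Longrightarrow> 0 < t \<Longrightarrow> (h k has_vector_derivative h (Suc k) t) (at t)"
    and "continuous_on {0<..} (h m)"
    and "\<And>k. k < m \<Longrightarrow> \<exists>C. \<forall>t>0. t ^ k * norm (h k t) \<le> C * exp (t / 2)"
    and "\<exists>B. \<forall>i. integral (window i) (\<lambda>t. norm (poisson_kernel (n + m) t *\<^sub>R h m t)) \<le> B"
proof -
  let ?S = "RL_boundary b (\<lambda>j. U j 0)" and ?F = "\<lambda>k. frac_conv b (\<lambda>_. 1) (U k)"
  show "(h k has_vector_derivative h (Suc k) t) (at t)" if "k < m" "0 < t" for k t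
  proof -
    have "(?F k has_vector_derivative (frac_kernel b t * 1) *\<^sub>R U k 0 + ?F (Suc k) t) (at t)"
      using that by (intro frac_conv_has_vector_derivative[where q' = "\<lambda>_. 0"] b U c) auto
    from has_vector_derivative_add[OF RL_boundary_has_vector_derivative[OF that(2), of b "\<lambda>j. U j 0" k] this]
    show ?thesis by (simp add: h_def)
  qed
  have Sc: "continuous_on {0<..} (?S k)" for k
    by (rule continuous_on_vector_derivative)
      (use RL_boundary_has_vector_derivative has_vector_derivative_at_within in blast)
  have Fc: "continuous_on {0<..} (?F m)"
    by (rule continuous_on_subset[OF continuous_on_frac_conv[OF b _ c]]) auto
  show "continuous_on {0<..} (h m)"
    unfolding h_def by (intro continuous_intros Sc Fc)
  show "\<exists>C. \<forall>t>0. t ^ k * norm (h k t) \<le> C * exp (t / 2)" if k: "k < m" for k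
  proof -
    obtain C where "\<And>t. 0 \<le> t \<Longrightarrow> norm (U k t) \<le> C * exp (t / 4)"
      using lower_derivatives_exp_bound[of m U, OF U c B k] by blast
    then obtain D where D: "\<And>t. 0 < t \<Longrightarrow> t ^ k * norm (?F k t) \<le> D * exp (t / 2)"
      using frac_conv_bound[OF b c[of k], of C k] k by auto
    obtain E where E: "\<And>t. 0 < t \<Longrightarrow> t ^ k * norm (?S k t) \<le> E * exp (t / 2)"
      using RL_boundary_bound[OF b] by blast
    have "t ^ k * norm (h k t) \<le> (E + D) * exp (t / 2)" if t: "0 < t" for t
    proof -
      have "t ^ k * norm (h k t) \<le> t ^ k * (norm (?S k t) + norm (?F k t))"
        unfolding h_def using t by (intro mult_left_mono norm_triangle_ineq) auto
      then show ?thesis using D[OF t] E[OF t] by (simp add: distrib_left distrib_right)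
    qed
    then show ?thesis by blast
  qed
  obtain E where E: "\<And>t. 0 < t \<Longrightarrow> t ^ m * norm (?S m t) \<le> E * exp (t / 2)"
    using RL_boundary_bound[OF b] by blast
  let ?p = "poisson_kernel (n + m)"
  have "integral (window i) (\<lambda>t. norm (?p t *\<^sub>R h m t))
      \<le> 4 ^ (n + m - m) * E / (1 / 4) + (\<Sum>j\<le>n + m. B * cesaro b (n + m - j))" for i
  proof -
    have "integral (window i) (\<lambda>t. norm (?p t *\<^sub>R h m t))
        \<le> integral (window i) (\<lambda>t. norm (?p t *\<^sub>R ?S m t) + norm (?p t *\<^sub>R ?F m t))"
      unfolding h_def scaleR_add_right
      by (intro integral_le integrable_on_window continuous_intros Sc Fc norm_triangle_ineq)
    also have "\<dots> = integral (window i) (\<lambda>t. norm (?p t *\<^sub>R ?S m t)) + integral (window i) (\<lambda>t. norm (?p t *\<^sub>R ?F m t))"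
      by (intro integral_add integrable_on_window continuous_intros Sc Fc)
    also have "\<dots> \<le> 4 ^ (n + m - m) * E / (1 / 4) + (\<Sum>j\<le>n + m. B * cesaro b (n + m - j))"
      by (intro add_mono integral_window_norm_le_exp frac_conv_poisson_L1_bound b c B order_refl
          norm_poisson_kernel_weight_le E continuous_intros Sc) auto
    finally show ?thesis .
  qed
  then show "\<exists>B. \<forall>i. integral (window i) (\<lambda>t. norm (?p t *\<^sub>R h m t)) \<le> B" by blast
qed

theorem theorem5p5:
  fixes u :: "real \<Rightarrow> 'a::complex_banach" and m :: nat and \<alpha> \<omega> :: real
  assumes "m \<ge> 1" and "real m - 1 < \<alpha>" and "\<alpha> \<le> real m"
    and "u \<in> C_nonneg m"
    and "0 < \<omega>" and "\<omega> < 1"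
    and "bochner_integrable {0..} (\<lambda>t. exp (\<omega> * t) *\<^sub>R iter_deriv m u t)"
  shows "RL_deriv_exists \<alpha> u \<and>
    (\<forall>n. bochner_integrable {0..} (\<lambda>t. poisson_kernel n t *\<^sub>R u t)) \<and>
    (\<forall>n. bochner_integrable {0..} (\<lambda>t. poisson_kernel (n + m) t *\<^sub>R RL_deriv \<alpha> u t) \<and>
         poisson (RL_deriv \<alpha> u) (n + m)
           = bochner {0..} (\<lambda>t. poisson_kernel (n + m) t *\<^sub>R RL_deriv \<alpha> u t) \<and>
         bochner {0..} (\<lambda>t. poisson_kernel (n + m) t *\<^sub>R RL_deriv \<alpha> u t)
           = RL_diff \<alpha> (poisson u) n)"
proof -
  have m: "nat \<lceil>\<alpha>\<rceil> = m"
    using assms(1-3) by linarith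
  define U where "U k = iter_deriv k u" for k
  have U0: "U 0 = u" by (simp add: U_def iter_deriv_def)
  have U: "(U k has_vector_derivative U (Suc k) t) (at t within {0..})" if "k < m" "0 \<le> t" for k t
    using assms(4) that vector_derivative_works[of "iter_deriv k u" "at t within {0..}"]
    by (auto simp: U_def iter_deriv_Suc C_nonneg_def times_differentiable_on_def)
  have c: "continuous_on {0..} (U k)" if "k \<le> m" for k
    using assms(4) that by (auto simp: U_def C_nonneg_def)
  have uc: "continuous_on {0..} u" using c[of 0] U0 by simp
  obtain B where B: "\<And>T. integral {0..T} (\<lambda>s. norm (U m s)) \<le> B"
    using exp_weighted_integrable_bound[OF c[of m], of \<omega>] assms(5,7) by (auto simp: U_def)
  have exp_bound: "\<exists>C. \<forall>t\<ge>0. norm (U k t) \<le> C * exp (t / 4)" if "k < m" for k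
    by (rule lower_derivatives_exp_bound[of m U, OF U c B that])
  obtain C where C: "\<And>t. 0 \<le> t \<Longrightarrow> norm (u t) \<le> C * exp (t / 4)"
    using exp_bound[of 0] assms(1) U0 by auto
  note Pu = poisson_of_exp_bounded[OF uc C]
  have main: "RL_deriv_exists \<alpha> u \<and> (\<forall>n. has_bochner {0..}
      (\<lambda>t. poisson_kernel (n + m) t *\<^sub>R RL_deriv \<alpha> u t) (RL_diff \<alpha> (poisson u) n))"
  proof (cases "\<alpha> = real m")
    case True
    have part: "RL_integral_part \<alpha> u t = U 0 t" for t
      by (simp add: RL_integral_part_def m True U0)
    have der: "(U k has_vector_derivative U (Suc k) t) (at t)" if "k < m" "0 < t" for k t
      using U[OF that(1), of t] that at_within_nonneg[OF that(2)] by simp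
    have cm: "continuous_on {0<..} (U m)" by (rule continuous_on_subset[OF c]) auto
    have bound: "\<exists>C. \<forall>t>0. t ^ k * norm (U k t) \<le> C * exp (t / 2)" if k: "k < m" for k
    proof -
      obtain D where D: "\<And>t. 0 \<le> t \<Longrightarrow> norm (U k t) \<le> D * exp (t / 4)" using exp_bound[OF k] by blast
      have D0: "0 \<le> D" using order_trans[OF norm_ge_zero D[of 0]] by simp
      obtain K where K: "\<And>t. 0 < t \<Longrightarrow> t powr real k * exp (t / 4) \<le> K * exp (t / 2)"
        using powr_exp_bound[of "real k"] by auto
      have "t ^ k * norm (U k t) \<le> D * K * exp (t / 2)" if t: "0 < t" for t
      proof -
        have "t ^ k * norm (U k t) \<le> t ^ k * (D * exp (t / 4))"
          using t by (intro mult_left_mono D) auto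
        also have "\<dots> = D * (t powr real k * exp (t / 4))" using t by (simp add: powr_realpow)
        also have "\<dots> \<le> D * (K * exp (t / 2))" by (intro mult_left_mono K t D0)
        finally show ?thesis by simp
      qed
      then show ?thesis by blast
    qed
    have L1: "\<exists>B. \<forall>i. integral (window i) (\<lambda>t. norm (poisson_kernel (n + m) t *\<^sub>R U m t)) \<le> B" for n
    proof (intro exI[of _ B] allI)
      fix i
      have "integral (window i) (\<lambda>t. norm (poisson_kernel (n + m) t *\<^sub>R U m t)) \<le> integral (window i) (\<lambda>t. norm (U m t))"
        using window_subset[of i]
        by (intro integral_le integrable_on_window continuous_intros cm)
          (auto simp: poisson_kernel_nonneg poisson_kernel_le_1 less_imp_le intro!: mult_left_le_one_le)
      also have "\<dots> \<le> integral {0..real i + 1} (\<lambda>t. norm (U m t))"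
        using window_subset[of i]
        by (intro integral_subset_le integrable_continuous_real continuous_intros continuous_on_subset[OF c[of m]]) auto
      finally show "integral (window i) (\<lambda>t. norm (poisson_kernel (n + m) t *\<^sub>R U m t)) \<le> B"
        using B by (rule order_trans)
    qed
    have lim: "(\<lambda>i. integral (window i) (\<lambda>t. poisson_kernel n t *\<^sub>R U 0 t)) \<longlonglongrightarrow> RL_sum_part \<alpha> (poisson u) n" for n
      using Pu(2)[of n] by (simp add: U0 RL_sum_part_def m True)
    show ?thesis
      using poisson_RL_deriv[of \<alpha> m u U, OF m part der cm bound L1 lim] m True
      by (auto simp: RL_deriv_exists_def)
  next
    case False
    define b where "b = real m - \<alpha>"
    have b: "0 < b" using False assms(3) by (simp add: b_def)
    define h where "h k t = RL_boundary b (\<lambda>j. U j 0) k t + frac_conv b (\<lambda>_. 1) (U k) t" for k t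
    have RL: "has_bochner {0..t} (\<lambda>s. frac_kernel b (t - s) *\<^sub>R u s) (frac_conv b (\<lambda>_. 1) u t)" if "0 < t" for t
      by (rule RL_integral_has_bochner[OF b uc that])
    have h0: "h 0 t = frac_conv b (\<lambda>_. 1) u t" for t by (simp add: h_def RL_boundary_def U0)
    have part: "RL_integral_part \<alpha> u t = h 0 t" if "0 < t" for t
      using bochner_eq[OF _ RL[OF that]] False by (simp add: RL_integral_part_def m b_def[symmetric] h0)
    have lim: "(\<lambda>i. integral (window i) (\<lambda>t. poisson_kernel n t *\<^sub>R h 0 t)) \<longlonglongrightarrow> RL_sum_part \<alpha> (poisson u) n" for n
      using poisson_frac_conv_limit[OF b uc C, of n] False by (simp add: h0 RL_sum_part_def m b_def[symmetric])
    note chain = RL_chain[of b m U, OF b U c B, folded h_def]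
    show ?thesis
      using poisson_RL_deriv[of \<alpha> m u h, OF m part chain lim] RL False
      by (auto simp: RL_deriv_exists_def m bochner_integrable_def b_def[symmetric])
  qed
  have "bochner {0..} (\<lambda>t. poisson_kernel (n + m) t *\<^sub>R RL_deriv \<alpha> u t) = RL_diff \<alpha> (poisson u) n" for n
    using main by (intro bochner_eq) auto
  then show ?thesis
    using main Pu(1) unfolding poisson_def bochner_integrable_def by auto
qed

end
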